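(* Let $\mathcal D$ be a pre-triangulated category, let $\mathcal C$ be a triangulated category, and let $F:\mathcal D\to\mathcal C$ be an exact and separable functor. Then the given pre-triangulation on $\mathcal D$ satisfies $\mathrm{TR4}$.
   Context: All categories are additive; $gf$ means first $f$, then $g$. A suspended category is an additive category with an additive autoequivalence $\Sigma$. A candidate triangle is $X\xrightarrow{u}Y\xrightarrow{v}Z\xrightarrow{w}\Sigma X$ with $vu=0$, $wv=0$, $\Sigma(u)w=0$; morphisms are triples $(f,g,h)$ with $gu=u'f$, $hv=v'g$, $w'h=\Sigma(f)w$. A pre-triangulation is a class of candidate triangles, called distinguished, satisfying: (TR1) it is closed under isomorphism, contains $X\xrightarrow{1}X\to0\to\Sigma X$, and every morphism is the first map of a distinguished triangle; (TR2) $(u,v,w)$ is distinguished iff $(v,w,-\Sigma(u))$ is; (TR3) every commutative square on the first maps of two distinguished triangles extends to a morphism of candidate triangles. A category with a pre-triangulation is pre-triangulated; it is triangulated if also (TR4), Verdier's octahedral axiom, holds: given distinguished $X\xrightarrow{u}Y\xrightarrow{i}X'\xrightarrow{i'}\Sigma X$, $Y\xrightarrow{v}Z\xrightarrow{j}Z'\xrightarrow{j'}\Sigma Y$, $X\xrightarrow{vu}Z\xrightarrow{k}Y'\xrightarrow{k'}\Sigma X$, there are $u':X'\to Y'$, $v':Y'\to Z'$ with $u'i=kv$, $v'k=j$, $k'u'=i'$, $j'v'=\Sigma(u)k'$ and $X'\xrightarrow{u'}Y'\xrightarrow{v'}Z'\xrightarrow{\Sigma(i)j'}\Sigma X'$ distinguished.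 An exact functor $F:\mathcal D\to\mathcal C$ is an additive functor with a natural isomorphism $\epsilon:F\Sigma_{\mathcal D}\xrightarrow{\sim}\Sigma_{\mathcal C}F$ such that for every distinguished $(u,v,w)$ with first object $X$ the triangle $(F(u),F(v),\epsilon_X\circ F(w))$ is distinguished. An additive functor $F$ is separable if there are group homomorphisms $H_{X,Y}:\mathcal C(F(X),F(Y))\to\mathcal D(X,Y)$ with $H_{X,Y}(F(a))=a$ for all $a:X\to Y$ and $H_{X',Y'}(F(v)\circ b\circ F(u))=v\circ H_{X,Y}(b)\circ u$ for all $u:X'\to X$, $b:F(X)\to F(Y)$, $v:Y\to Y'$. *)

theory Defs
  imports "HOL-Algebra.Group"
begin

section \<open>Additive categories\<close>

text \<open>
  Objects and morphisms are arbitrary sets inside the types \<open>'o\<close> and \<open>'m\<close>; every morphism has a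
  unique domain and codomain, so that hom-sets are disjoint. The composite \<open>g \<cdot> f\<close> means
  first \<open>f\<close>, then \<open>g\<close>. All operations are only meaningful on composable (respectively parallel)
  morphisms; their values elsewhere are irrelevant.
\<close>

record ('o, 'm) addcat =
  Obj :: "'o set"
  Arr :: "'m set"
  Dom :: "'m \<Rightarrow> 'o"
  Cod :: "'m \<Rightarrow> 'o"
  Id :: "'o \<Rightarrow> 'm"
  Comp :: "'m \<Rightarrow> 'm \<Rightarrow> 'm"  (infixr "\<cdot>\<index>" 70)
  Plus :: "'m \<Rightarrow> 'm \<Rightarrow> 'm"
  Null :: "'o \<Rightarrow> 'o \<Rightarrow> 'm"

definition Hom :: "('o, 'm) addcat \<Rightarrow> 'o \<Rightarrow> 'o \<Rightarrow> 'm set" where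
  "Hom C X Y = {f \<in> Arr C. Dom C f = X \<and> Cod C f = Y}"

definition hom_group :: "('o, 'm) addcat \<Rightarrow> 'o \<Rightarrow> 'o \<Rightarrow> 'm monoid" where
  "hom_group C X Y = \<lparr>carrier = Hom C X Y, mult = Plus C, one = Null C X Y\<rparr>"

definition Neg :: "('o, 'm) addcat \<Rightarrow> 'm \<Rightarrow> 'm" where
  "Neg C f = m_inv (hom_group C (Dom C f) (Cod C f)) f"

definition is_iso :: "('o, 'm) addcat \<Rightarrow> 'm \<Rightarrow> bool" where
  "is_iso C f \<longleftrightarrow> f \<in> Arr C \<and>
     (\<exists>g \<in> Hom C (Cod C f) (Dom C f). g \<cdot>\<^bsub>C\<^esub> f = Id C (Dom C f) \<and> f \<cdot>\<^bsub>C\<^esub> g = Id C (Cod C f))"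

definition zero_object :: "('o, 'm) addcat \<Rightarrow> 'o \<Rightarrow> bool" where
  "zero_object C Z \<longleftrightarrow> Z \<in> Obj C \<and>
     (\<forall>X \<in> Obj C. (\<exists>!f. f \<in> Hom C X Z) \<and> (\<exists>!f. f \<in> Hom C Z X))"

definition biproduct ::
  "('o, 'm) addcat \<Rightarrow> 'o \<Rightarrow> 'o \<Rightarrow> 'o \<Rightarrow> 'm \<Rightarrow> 'm \<Rightarrow> 'm \<Rightarrow> 'm \<Rightarrow> bool" where
  "biproduct C X Y B i1 i2 p1 p2 \<longleftrightarrow> B \<in> Obj C \<and>
     i1 \<in> Hom C X B \<and> i2 \<in> Hom C Y B \<and> p1 \<in> Hom C B X \<and> p2 \<in> Hom C B Y \<and>
     p1 \<cdot>\<^bsub>C\<^esub> i1 = Id C X \<and> p2 \<cdot>\<^bsub>C\<^esub> i2 = Id C Y \<and>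
     p1 \<cdot>\<^bsub>C\<^esub> i2 = Null C Y X \<and> p2 \<cdot>\<^bsub>C\<^esub> i1 = Null C X Y \<and>
     Plus C (i1 \<cdot>\<^bsub>C\<^esub> p1) (i2 \<cdot>\<^bsub>C\<^esub> p2) = Id C B"

locale category =
  fixes C :: "('o, 'm) addcat" (structure)
  assumes Dom_Obj: "f \<in> Arr C \<Longrightarrow> Dom C f \<in> Obj C"
    and Cod_Obj: "f \<in> Arr C \<Longrightarrow> Cod C f \<in> Obj C"
    and Id_Hom: "X \<in> Obj C \<Longrightarrow> Id C X \<in> Hom C X X"
    and Comp_Hom: "f \<in> Hom C X Y \<Longrightarrow> g \<in> Hom C Y Z \<Longrightarrow> g \<cdot> f \<in> Hom C X Z"
    and Id_left: "f \<in> Hom C X Y \<Longrightarrow> Id C Y \<cdot> f = f"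
    and Id_right: "f \<in> Hom C X Y \<Longrightarrow> f \<cdot> Id C X = f"
    and Comp_assoc: "f \<in> Hom C W X \<Longrightarrow> g \<in> Hom C X Y \<Longrightarrow> h \<in> Hom C Y Z \<Longrightarrow>
           (h \<cdot> g) \<cdot> f = h \<cdot> (g \<cdot> f)"

locale additive_category = category +
  assumes hom_comm_group: "X \<in> Obj C \<Longrightarrow> Y \<in> Obj C \<Longrightarrow> comm_group (hom_group C X Y)"
    and Comp_Plus: "f \<in> Hom C X Y \<Longrightarrow> g \<in> Hom C X Y \<Longrightarrow> h \<in> Hom C Y Z \<Longrightarrow>
           h \<cdot> Plus C f g = Plus C (h \<cdot> f) (h \<cdot> g)"
    and Plus_Comp: "f \<in> Hom C Y Z \<Longrightarrow> g \<in> Hom C Y Z \<Longrightarrow> h \<in> Hom C X Y \<Longrightarrow>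
           Plus C f g \<cdot> h = Plus C (f \<cdot> h) (g \<cdot> h)"
    and ex_zero_object: "\<exists>Z. zero_object C Z"
    and ex_biproduct: "X \<in> Obj C \<Longrightarrow> Y \<in> Obj C \<Longrightarrow>
           \<exists>B i1 i2 p1 p2. biproduct C X Y B i1 i2 p1 p2"


section \<open>Functors\<close>

record ('o, 'm, 'p, 'n) functor_maps =
  omap :: "'o \<Rightarrow> 'p"
  amap :: "'m \<Rightarrow> 'n"

definition id_functor :: "('o, 'm, 'o, 'm) functor_maps" where
  "id_functor = \<lparr>omap = (\<lambda>X. X), amap = (\<lambda>f. f)\<rparr>"

definition comp_functor ::
  "('p, 'n, 'q, 'k) functor_maps \<Rightarrow> ('o, 'm, 'p, 'n) functor_maps \<Rightarrow> ('o, 'm, 'q, 'k) functor_maps"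
  (infixr "\<circ>\<^sub>F" 55) where
  "G \<circ>\<^sub>F F = \<lparr>omap = omap G \<circ> omap F, amap = amap G \<circ> amap F\<rparr>"

locale functor_between = source: category C + target: category D
  for C :: "('o, 'm) addcat" and D :: "('p, 'n) addcat" +
  fixes F :: "('o, 'm, 'p, 'n) functor_maps"
  assumes omap_Obj: "X \<in> Obj C \<Longrightarrow> omap F X \<in> Obj D"
    and amap_Hom: "f \<in> Hom C X Y \<Longrightarrow> amap F f \<in> Hom D (omap F X) (omap F Y)"
    and amap_Id: "X \<in> Obj C \<Longrightarrow> amap F (Id C X) = Id D (omap F X)"
    and amap_Comp: "f \<in> Hom C X Y \<Longrightarrow> g \<in> Hom C Y Z \<Longrightarrow>
           amap F (g \<cdot>\<^bsub>C\<^esub> f) = amap F g \<cdot>\<^bsub>D\<^esub> amap F f"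

locale additive_functor =
    functor_between C D F + source: additive_category C + target: additive_category D
  for C :: "('o, 'm) addcat" and D :: "('p, 'n) addcat"
    and F :: "('o, 'm, 'p, 'n) functor_maps" +
  assumes amap_Plus: "f \<in> Hom C X Y \<Longrightarrow> g \<in> Hom C X Y \<Longrightarrow>
            amap F (Plus C f g) = Plus D (amap F f) (amap F g)"

definition natural_iso ::
  "('o, 'm) addcat \<Rightarrow> ('p, 'n) addcat \<Rightarrow> ('o, 'm, 'p, 'n) functor_maps \<Rightarrow>
   ('o, 'm, 'p, 'n) functor_maps \<Rightarrow> ('o \<Rightarrow> 'n) \<Rightarrow> bool" where
  "natural_iso C D F G \<eta> \<longleftrightarrow>
     (\<forall>X \<in> Obj C. \<eta> X \<in> Hom D (omap F X) (omap G X) \<and> is_iso D (\<eta> X)) \<and>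
     (\<forall>X Y. \<forall>f \<in> Hom C X Y. \<eta> Y \<cdot>\<^bsub>D\<^esub> amap F f = amap G f \<cdot>\<^bsub>D\<^esub> \<eta> X)"

definition cat_equivalence ::
  "('o, 'm) addcat \<Rightarrow> ('p, 'n) addcat \<Rightarrow> ('o, 'm, 'p, 'n) functor_maps \<Rightarrow> bool" where
  "cat_equivalence C D F \<longleftrightarrow> functor_between C D F \<and>
     (\<exists>G. functor_between D C G \<and>
        (\<exists>\<eta>. natural_iso C C id_functor (G \<circ>\<^sub>F F) \<eta>) \<and>
        (\<exists>\<theta>. natural_iso D D (F \<circ>\<^sub>F G) id_functor \<theta>))"

text \<open>
  The group homomorphism \<open>H X Y\<close> is only constrained on the hom-set from \<open>F X\<close> to \<open>F Y\<close>.
\<close>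

locale separable_functor = additive_functor D C F
  for D :: "('o, 'm) addcat" and C :: "('p, 'n) addcat"
    and F :: "('o, 'm, 'p, 'n) functor_maps" +
  assumes separable: "\<exists>H :: 'o \<Rightarrow> 'o \<Rightarrow> 'n \<Rightarrow> 'm.
     (\<forall>X \<in> Obj D. \<forall>Y \<in> Obj D.
        H X Y \<in> hom (hom_group C (omap F X) (omap F Y)) (hom_group D X Y)) \<and>
     (\<forall>X \<in> Obj D. \<forall>Y \<in> Obj D. \<forall>a \<in> Hom D X Y. H X Y (amap F a) = a) \<and>
     (\<forall>X' \<in> Obj D. \<forall>X \<in> Obj D. \<forall>Y \<in> Obj D. \<forall>Y' \<in> Obj D.
        \<forall>u \<in> Hom D X' X. \<forall>b \<in> Hom C (omap F X) (omap F Y). \<forall>v \<in> Hom D Y Y'.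
          H X' Y' (amap F v \<cdot>\<^bsub>C\<^esub> b \<cdot>\<^bsub>C\<^esub> amap F u) = v \<cdot>\<^bsub>D\<^esub> H X Y b \<cdot>\<^bsub>D\<^esub> u)"


section \<open>Suspended categories and candidate triangles\<close>

locale suspended_category = additive_functor C C S
  for C :: "('o, 'm) addcat" and S :: "('o, 'm, 'o, 'm) functor_maps" +
  assumes S_equivalence: "cat_equivalence C C S"

text \<open>A triangle is given by its three morphisms, which determine its objects.\<close>

definition candidate_triangle ::
  "('o, 'm) addcat \<Rightarrow> ('o, 'm, 'o, 'm) functor_maps \<Rightarrow> 'm \<times> 'm \<times> 'm \<Rightarrow> bool" where
  "candidate_triangle C S = (\<lambda>(u, v, w). \<exists>X \<in> Obj C. \<exists>Y \<in> Obj C. \<exists>Z \<in> Obj C.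
     u \<in> Hom C X Y \<and> v \<in> Hom C Y Z \<and> w \<in> Hom C Z (omap S X) \<and>
     v \<cdot>\<^bsub>C\<^esub> u = Null C X Z \<and>
     w \<cdot>\<^bsub>C\<^esub> v = Null C Y (omap S X) \<and>
     amap S u \<cdot>\<^bsub>C\<^esub> w = Null C Z (omap S Y))"

definition triangle_morphism ::
  "('o, 'm) addcat \<Rightarrow> ('o, 'm, 'o, 'm) functor_maps \<Rightarrow>
   'm \<times> 'm \<times> 'm \<Rightarrow> 'm \<times> 'm \<times> 'm \<Rightarrow> 'm \<Rightarrow> 'm \<Rightarrow> 'm \<Rightarrow> bool" where
  "triangle_morphism C S = (\<lambda>(u, v, w) (u', v', w') f g h.
     f \<in> Hom C (Dom C u) (Dom C u') \<and>
     g \<in> Hom C (Dom C v) (Dom C v') \<and>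
     h \<in> Hom C (Dom C w) (Dom C w') \<and>
     g \<cdot>\<^bsub>C\<^esub> u = u' \<cdot>\<^bsub>C\<^esub> f \<and>
     h \<cdot>\<^bsub>C\<^esub> v = v' \<cdot>\<^bsub>C\<^esub> g \<and>
     w' \<cdot>\<^bsub>C\<^esub> h = amap S f \<cdot>\<^bsub>C\<^esub> w)"

definition triangle_isomorphic ::
  "('o, 'm) addcat \<Rightarrow> ('o, 'm, 'o, 'm) functor_maps \<Rightarrow> 'm \<times> 'm \<times> 'm \<Rightarrow> 'm \<times> 'm \<times> 'm \<Rightarrow> bool" where
  "triangle_isomorphic C S t t' \<longleftrightarrow>
     (\<exists>f g h. triangle_morphism C S t t' f g h \<and> is_iso C f \<and> is_iso C g \<and> is_iso C h)"


section \<open>Pre-triangulations and triangulations\<close>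

definition TR1 ::
  "('o, 'm) addcat \<Rightarrow> ('o, 'm, 'o, 'm) functor_maps \<Rightarrow> ('m \<times> 'm \<times> 'm) set \<Rightarrow> bool" where
  "TR1 C S T \<longleftrightarrow>
     (\<forall>t t'. t \<in> T \<longrightarrow> candidate_triangle C S t' \<longrightarrow> triangle_isomorphic C S t t' \<longrightarrow> t' \<in> T) \<and>
     (\<forall>X \<in> Obj C. \<forall>Z. zero_object C Z \<longrightarrow> (Id C X, Null C X Z, Null C Z (omap S X)) \<in> T) \<and>
     (\<forall>u \<in> Arr C. \<exists>v w. (u, v, w) \<in> T)"

definition TR2 ::
  "('o, 'm) addcat \<Rightarrow> ('o, 'm, 'o, 'm) functor_maps \<Rightarrow> ('m \<times> 'm \<times> 'm) set \<Rightarrow> bool" where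
  "TR2 C S T \<longleftrightarrow>
     (\<forall>u v w. candidate_triangle C S (u, v, w) \<longrightarrow>
        ((u, v, w) \<in> T \<longleftrightarrow> (v, w, Neg C (amap S u)) \<in> T))"

definition TR3 ::
  "('o, 'm) addcat \<Rightarrow> ('o, 'm, 'o, 'm) functor_maps \<Rightarrow> ('m \<times> 'm \<times> 'm) set \<Rightarrow> bool" where
  "TR3 C S T \<longleftrightarrow>
     (\<forall>u v w u' v' w' f g. (u, v, w) \<in> T \<longrightarrow> (u', v', w') \<in> T \<longrightarrow>
        f \<in> Hom C (Dom C u) (Dom C u') \<longrightarrow> g \<in> Hom C (Cod C u) (Cod C u') \<longrightarrow>
        g \<cdot>\<^bsub>C\<^esub> u = u' \<cdot>\<^bsub>C\<^esub> f \<longrightarrow>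
        (\<exists>h. triangle_morphism C S (u, v, w) (u', v', w') f g h))"

text \<open>
  Verdier's octahedral axiom; \<open>X1\<close>, \<open>Y1\<close>, \<open>Z1\<close> are the third objects of the triangles on
  \<open>u\<close>, \<open>v \<cdot> u\<close> and \<open>v\<close>.
\<close>

definition TR4 ::
  "('o, 'm) addcat \<Rightarrow> ('o, 'm, 'o, 'm) functor_maps \<Rightarrow> ('m \<times> 'm \<times> 'm) set \<Rightarrow> bool" where
  "TR4 C S T \<longleftrightarrow>
     (\<forall>X Y Z X1 Y1 Z1 u v i i' j j' k k'.
        u \<in> Hom C X Y \<longrightarrow> i \<in> Hom C Y X1 \<longrightarrow> i' \<in> Hom C X1 (omap S X) \<longrightarrow> (u, i, i') \<in> T \<longrightarrow>
        v \<in> Hom C Y Z \<longrightarrow> j \<in> Hom C Z Z1 \<longrightarrow> j' \<in> Hom C Z1 (omap S Y) \<longrightarrow> (v, j, j') \<in> T \<longrightarrow>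
        k \<in> Hom C Z Y1 \<longrightarrow> k' \<in> Hom C Y1 (omap S X) \<longrightarrow> (v \<cdot>\<^bsub>C\<^esub> u, k, k') \<in> T \<longrightarrow>
        (\<exists>u' \<in> Hom C X1 Y1. \<exists>v' \<in> Hom C Y1 Z1.
           u' \<cdot>\<^bsub>C\<^esub> i = k \<cdot>\<^bsub>C\<^esub> v \<and>
           v' \<cdot>\<^bsub>C\<^esub> k = j \<and>
           k' \<cdot>\<^bsub>C\<^esub> u' = i' \<and>
           j' \<cdot>\<^bsub>C\<^esub> v' = amap S u \<cdot>\<^bsub>C\<^esub> k' \<and>
           (u', v', amap S i \<cdot>\<^bsub>C\<^esub> j') \<in> T))"

locale pretriangulated_category = suspended_category C S
  for C :: "('o, 'm) addcat" and S :: "('o, 'm, 'o, 'm) functor_maps" +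
  fixes T :: "('m \<times> 'm \<times> 'm) set"
  assumes distinguished_candidate: "t \<in> T \<Longrightarrow> candidate_triangle C S t"
    and TR1: "TR1 C S T"
    and TR2: "TR2 C S T"
    and TR3: "TR3 C S T"

locale triangulated_category = pretriangulated_category +
  assumes TR4: "TR4 C S T"

locale exact_functor =
  D: pretriangulated_category D SD TD + C: pretriangulated_category C SC TC + additive_functor D C F
  for D :: "('o, 'm) addcat" and SD TD and C :: "('p, 'n) addcat" and SC TC
    and F :: "('o, 'm, 'p, 'n) functor_maps" +
  fixes \<epsilon> :: "'o \<Rightarrow> 'n"
  assumes \<epsilon>_natural_iso: "natural_iso D C (F \<circ>\<^sub>F SD) (SC \<circ>\<^sub>F F) \<epsilon>"
    and preserves_distinguished: "(u, v, w) \<in> TD \<Longrightarrow>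
          (amap F u, amap F v, \<epsilon> (Dom D u) \<cdot>\<^bsub>C\<^esub> amap F w) \<in> TC"

end

theory Submission
  imports Defs
begin

text \<open>
  Let \<open>W\<close> be the cone of \<open>f = (i, -v) : Y \<rightarrow> X1 \<oplus> Z\<close>. Composing \<open>f\<close>
  with the two projections gives \<open>i\<close> and \<open>-v\<close>, so in a triangulated category the octahedral axiom
  produces distinguished triangles \<open>Z \<rightarrow> W \<rightarrow> \<Sigma>X\<close> and \<open>X1 \<rightarrow> W \<rightarrow> Z1\<close> that are compatible because they
  share the cone of \<open>f\<close>. The first identifies \<open>W\<close> with the cone \<open>Y1\<close> of \<open>v \<cdot> u\<close>, the second is then the
  triangle \<open>X1 \<rightarrow> Y1 \<rightarrow> Z1\<close> required by TR4. Over a pre-triangulated source of a separable exact functor,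
  \<open>W\<close> still exists; the two triangles are formed in the target and pulled back by the retraction of the
  functor on morphisms. The pulled-back maps satisfy the same commutativities, and they are again part
  of distinguished triangles because the comparison with an actual cone is unipotent after applying the
  functor, and separable functors reflect isomorphisms.
\<close>

section \<open>Additive categories\<close>

text \<open>Hom-set membership is turned into facts about \<open>Arr\<close>, \<open>Dom\<close> and
  \<open>Cod\<close>, which the simplifier can compute for composites; the category axioms are
  restated below with premises of that kind.\<close>

lemma in_Hom [simp]: "f \<in> Hom C X Y \<longleftrightarrow> f \<in> Arr C \<and> Dom C f = X \<and> Cod C f = Y"
  by (simp add: Hom_def)

abbreviation Minus :: "('o, 'm) addcat \<Rightarrow> 'm \<Rightarrow> 'm \<Rightarrow> 'm" where
  "Minus C f g \<equiv> Plus C f (Neg C g)"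

section \<open>Composition and isomorphisms\<close>

context category
begin

lemmas Dom_Cod_Obj [simp] = Dom_Obj Cod_Obj

lemma Id_simps [simp]:
  assumes "X \<in> Obj C"
  shows "Id C X \<in> Arr C" "Dom C (Id C X) = X" "Cod C (Id C X) = X"
  using Id_Hom[OF assms] by simp_all

lemma Comp_simps [simp]:
  assumes "f \<in> Arr C" "g \<in> Arr C" "Dom C g = Cod C f"
  shows "g \<cdot> f \<in> Arr C" "Dom C (g \<cdot> f) = Dom C f" "Cod C (g \<cdot> f) = Cod C g"
  using Comp_Hom[of f "Dom C f" "Cod C f" g "Cod C g"] assms by simp_all

lemma Id_Comp [simp]: "f \<in> Arr C \<Longrightarrow> Cod C f = Y \<Longrightarrow> Id C Y \<cdot> f = f"
  using Id_left[of f "Dom C f" Y] by simp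

lemma Comp_Id [simp]: "f \<in> Arr C \<Longrightarrow> Dom C f = X \<Longrightarrow> f \<cdot> Id C X = f"
  using Id_right[of f X "Cod C f"] by simp

lemma assoc [simp]:
  assumes "f \<in> Arr C" "g \<in> Arr C" "h \<in> Arr C" "Dom C g = Cod C f" "Dom C h = Cod C g"
  shows "(h \<cdot> g) \<cdot> f = h \<cdot> (g \<cdot> f)"
  using Comp_assoc[of f "Dom C f" "Cod C f" g "Cod C g" h "Cod C h"] assms by simp

text \<open>Since \<open>assoc\<close> normalises composites to the right, a known value of
  \<open>h \<cdot> g\<close> no longer matches once another morphism precedes \<open>g\<close>; this
  is the rule for that situation.\<close>

lemma Comp_reduce:
  assumes "h \<cdot> g = k" "f \<in> Arr C" "g \<in> Arr C" "h \<in> Arr C" "Dom C g = Cod C f" "Dom C h = Cod C g"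
  shows "h \<cdot> (g \<cdot> f) = k \<cdot> f"
  using assms assoc by metis

lemma is_isoI:
  assumes "f \<in> Hom C X Y" "g \<in> Hom C Y X" "g \<cdot> f = Id C X" "f \<cdot> g = Id C Y"
  shows "is_iso C f"
  using assms unfolding is_iso_def by auto

lemma is_isoE:
  assumes "is_iso C f" "f \<in> Hom C X Y"
  obtains g where "g \<in> Hom C Y X" "g \<cdot> f = Id C X" "f \<cdot> g = Id C Y" "is_iso C g"
proof -
  obtain g where g: "g \<in> Hom C Y X" "g \<cdot> f = Id C X" "f \<cdot> g = Id C Y"
    using assms unfolding is_iso_def by auto
  then show thesis using that[of g] is_isoI[of g Y X f] assms by blast
qed

lemma is_iso_Id: "X \<in> Obj C \<Longrightarrow> is_iso C (Id C X)"
  by (rule is_isoI[of _ X X "Id C X"]) auto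

lemma is_iso_two_sided:
  assumes "f \<in> Hom C X Y" "g \<in> Hom C Y X" "h \<in> Hom C Y X" "g \<cdot> f = Id C X" "f \<cdot> h = Id C Y"
  shows "is_iso C f"
proof -
  have "g = g \<cdot> (f \<cdot> h)" using assms by simp
  also have "\<dots> = (g \<cdot> f) \<cdot> h" by (rule assoc[symmetric]) (use assms(1-3) in simp_all)
  also have "\<dots> = h" unfolding assms(4) using assms(3) by simp
  finally show ?thesis using assms is_isoI by metis
qed

lemma Comp_cancel_iso:
  assumes "is_iso C f" "x \<in> Arr C" "y \<in> Arr C" "f \<in> Arr C" "Dom C x = Cod C f" "Dom C y = Cod C f"
    and "x \<cdot> f = y \<cdot> f"
  shows "x = y"
proof -
  obtain g where g: "g \<in> Hom C (Cod C f) (Dom C f)" "f \<cdot> g = Id C (Cod C f)"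
    using is_isoE[OF assms(1), of "Dom C f" "Cod C f"] assms by auto
  have "x = (x \<cdot> f) \<cdot> g" using assms(2-6) g by simp
  also have "\<dots> = y" unfolding assms(7) using assms(2-6) g by simp
  finally show ?thesis .
qed

text \<open>An inverse of \<open>g \<cdot> f\<close> gives a left inverse of \<open>f\<close>, an
  inverse of \<open>f \<cdot> g\<close> a right one. Comparison maps between cones exist in both
  directions without being mutually inverse, and this criterion is what applies to them.\<close>

lemma is_iso_both_composites:
  assumes f: "f \<in> Hom C X Y" and g: "g \<in> Hom C Y X"
    and "is_iso C (g \<cdot> f)" "is_iso C (f \<cdot> g)"
  shows "is_iso C f"
proof -
  obtain x where x: "x \<in> Hom C X X" "x \<cdot> (g \<cdot> f) = Id C X"
    using is_isoE[OF assms(3), of X X] f g by auto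
  obtain y where y: "y \<in> Hom C Y Y" "(f \<cdot> g) \<cdot> y = Id C Y"
    using is_isoE[OF assms(4), of Y Y] f g by auto
  show ?thesis
    by (rule is_iso_two_sided[of f X Y "x \<cdot> g" "g \<cdot> y"]) (use f g x y in auto)
qed

lemma Comp_cancel_iso_left:
  assumes "is_iso C f" "x \<in> Arr C" "y \<in> Arr C" "f \<in> Arr C" "Dom C f = Cod C x" "Dom C f = Cod C y"
    and "f \<cdot> x = f \<cdot> y"
  shows "x = y"
proof -
  obtain g where g: "g \<in> Hom C (Cod C f) (Dom C f)" "g \<cdot> f = Id C (Dom C f)"
    using is_isoE[OF assms(1), of "Dom C f" "Cod C f"] assms by auto
  have "x = g \<cdot> (f \<cdot> x)" using assms(2-6) g by (simp add: Comp_reduce[OF g(2)])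
  also have "\<dots> = y" unfolding assms(7) using assms(2-6) g by (simp add: Comp_reduce[OF g(2)])
  finally show ?thesis .
qed

lemma is_iso_Comp:
  assumes f: "f \<in> Hom C X Y" "is_iso C f" and g: "g \<in> Hom C Y Z" "is_iso C g"
  shows "is_iso C (g \<cdot> f)"
proof -
  obtain f' where f': "f' \<in> Hom C Y X" "f' \<cdot> f = Id C X" "f \<cdot> f' = Id C Y"
    using is_isoE[OF f(2,1)] by blast
  obtain g' where g': "g' \<in> Hom C Z Y" "g' \<cdot> g = Id C Y" "g \<cdot> g' = Id C Z"
    using is_isoE[OF g(2,1)] by blast
  show ?thesis
    by (rule is_isoI[of _ X Z "f' \<cdot> g'"])
      (use f(1) g(1) f' g' in \<open>simp_all add: Comp_reduce[OF g'(2)] Comp_reduce[OF f'(3)]\<close>)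
qed

end

section \<open>Arithmetic of hom-groups, unipotent endomorphisms, zero objects\<close>

context additive_category
begin

lemma Null_simps [simp]:
  assumes "X \<in> Obj C" "Y \<in> Obj C"
  shows "Null C X Y \<in> Arr C" "Dom C (Null C X Y) = X" "Cod C (Null C X Y) = Y"
proof -
  interpret comm_group "hom_group C X Y" by (rule hom_comm_group[OF assms])
  have "Null C X Y \<in> Hom C X Y" using one_closed by (simp add: hom_group_def)
  then show "Null C X Y \<in> Arr C" "Dom C (Null C X Y) = X" "Cod C (Null C X Y) = Y" by auto
qed

lemma Plus_simps [simp]:
  assumes "f \<in> Arr C" "g \<in> Arr C" "Dom C g = Dom C f" "Cod C g = Cod C f"
  shows "Plus C f g \<in> Arr C" "Dom C (Plus C f g) = Dom C f" "Cod C (Plus C f g) = Cod C f"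
proof -
  interpret comm_group "hom_group C (Dom C f) (Cod C f)" by (rule hom_comm_group) (use assms in auto)
  have "Plus C f g \<in> Hom C (Dom C f) (Cod C f)"
    using m_closed[of f g] assms by (simp add: hom_group_def)
  then show "Plus C f g \<in> Arr C" "Dom C (Plus C f g) = Dom C f" "Cod C (Plus C f g) = Cod C f"
    by auto
qed

lemma Neg_simps [simp]:
  assumes "f \<in> Arr C"
  shows "Neg C f \<in> Arr C" "Dom C (Neg C f) = Dom C f" "Cod C (Neg C f) = Cod C f"
    "Plus C f (Neg C f) = Null C (Dom C f) (Cod C f)"
proof -
  interpret comm_group "hom_group C (Dom C f) (Cod C f)" by (rule hom_comm_group) (use assms in auto)
  have f: "f \<in> carrier (hom_group C (Dom C f) (Cod C f))" using assms by (simp add: hom_group_def)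
  show "Neg C f \<in> Arr C" "Dom C (Neg C f) = Dom C f" "Cod C (Neg C f) = Cod C f"
    using inv_closed[OF f] unfolding Neg_def by (simp_all add: hom_group_def)
  show "Plus C f (Neg C f) = Null C (Dom C f) (Cod C f)"
    using r_inv[OF f] unfolding Neg_def by (simp add: hom_group_def)
qed

lemma Plus_assoc:
  assumes "f \<in> Arr C" "g \<in> Arr C" "h \<in> Arr C" "Dom C g = Dom C f" "Cod C g = Cod C f"
    "Dom C h = Dom C f" "Cod C h = Cod C f"
  shows "Plus C (Plus C f g) h = Plus C f (Plus C g h)"
proof -
  interpret comm_group "hom_group C (Dom C f) (Cod C f)" by (rule hom_comm_group) (use assms in auto)
  show ?thesis using m_assoc[of f g h] assms by (simp add: hom_group_def)
qed

lemma Plus_commute: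
  assumes "f \<in> Arr C" "g \<in> Arr C" "Dom C g = Dom C f" "Cod C g = Cod C f"
  shows "Plus C f g = Plus C g f"
proof -
  interpret comm_group "hom_group C (Dom C f) (Cod C f)" by (rule hom_comm_group) (use assms in auto)
  show ?thesis using m_comm[of f g] assms by (simp add: hom_group_def)
qed

lemma Plus_Null [simp]:
  assumes "f \<in> Arr C" "Dom C f = X" "Cod C f = Y"
  shows "Plus C f (Null C X Y) = f" "Plus C (Null C X Y) f = f"
proof -
  interpret comm_group "hom_group C X Y" by (rule hom_comm_group) (use assms in auto)
  show "Plus C f (Null C X Y) = f" "Plus C (Null C X Y) f = f"
    using r_one[of f] l_one[of f] assms by (simp_all add: hom_group_def)
qed

text \<open>Uniqueness of additive inverses; the sign rules for \<open>Neg\<close> below follow from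
  it.\<close>

lemma Plus_eq_NullD:
  assumes "Plus C f g = Null C (Dom C f) (Cod C f)" "f \<in> Arr C" "g \<in> Arr C"
    "Dom C g = Dom C f" "Cod C g = Cod C f"
  shows "g = Neg C f"
proof -
  have "g = Plus C (Plus C (Neg C f) f) g" using assms by (simp add: Plus_commute[of "Neg C f" f])
  also have "\<dots> = Neg C f" using assms by (simp add: Plus_assoc)
  finally show ?thesis .
qed

text \<open>Composition and functors are only assumed to respect sums; that they preserve zero
  morphisms follows because the image of zero is its own double.\<close>

lemma Plus_idem_Null:
  assumes "Plus C f f = f" "f \<in> Arr C"
  shows "f = Null C (Dom C f) (Cod C f)"
proof -
  have "f = Plus C f (Minus C f f)" using assms by simp
  also have "\<dots> = Minus C (Plus C f f) f" using assms(2) by (simp add: Plus_assoc del: Neg_simps(4))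
  finally show ?thesis using assms by simp
qed

lemma Minus_eq_NullD:
  assumes "Minus C f g = Null C (Dom C f) (Cod C f)" "f \<in> Arr C" "g \<in> Arr C"
    "Dom C g = Dom C f" "Cod C g = Cod C f"
  shows "f = g"
proof -
  have "Plus C (Minus C f g) g = Plus C f (Plus C (Neg C g) g)"
    by (rule Plus_assoc) (use assms(2-) in simp_all)
  also have "\<dots> = f" using assms(2-) by (simp add: Plus_commute[of "Neg C g" g])
  finally show ?thesis using assms by simp
qed

lemma Comp_Plus_distrib:
  assumes "f \<in> Arr C" "g \<in> Arr C" "h \<in> Arr C" "Dom C g = Dom C f" "Cod C g = Cod C f"
    "Dom C h = Cod C f"
  shows "h \<cdot> Plus C f g = Plus C (h \<cdot> f) (h \<cdot> g)"
  using Comp_Plus[of f "Dom C f" "Cod C f" g h "Cod C h"] assms by simp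

lemma Plus_Comp_distrib:
  assumes "f \<in> Arr C" "g \<in> Arr C" "h \<in> Arr C" "Dom C g = Dom C f" "Cod C g = Cod C f"
    "Dom C f = Cod C h"
  shows "Plus C f g \<cdot> h = Plus C (f \<cdot> h) (g \<cdot> h)"
  using Plus_Comp[of f "Dom C f" "Cod C f" g h "Dom C h"] assms by simp

lemma Comp_Null [simp]:
  assumes "h \<in> Arr C" "X \<in> Obj C" "Dom C h = Y"
  shows "h \<cdot> Null C X Y = Null C X (Cod C h)"
proof -
  have Y: "Y \<in> Obj C" using assms by auto
  have "Plus C (h \<cdot> Null C X Y) (h \<cdot> Null C X Y) = h \<cdot> Null C X Y"
    using Comp_Plus_distrib[of "Null C X Y" "Null C X Y" h] assms Y by simp
  from Plus_idem_Null[OF this] show ?thesis using assms Y by simp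
qed

lemma Null_Comp [simp]:
  assumes "h \<in> Arr C" "Y \<in> Obj C" "Cod C h = X"
  shows "Null C X Y \<cdot> h = Null C (Dom C h) Y"
proof -
  have X: "X \<in> Obj C" using assms by auto
  have "Plus C (Null C X Y \<cdot> h) (Null C X Y \<cdot> h) = Null C X Y \<cdot> h"
    using Plus_Comp_distrib[of "Null C X Y" "Null C X Y" h] assms X by simp
  from Plus_idem_Null[OF this] show ?thesis using assms X by simp
qed

lemma Comp_Neg [simp]:
  assumes "f \<in> Arr C" "h \<in> Arr C" "Dom C h = Cod C f"
  shows "h \<cdot> Neg C f = Neg C (h \<cdot> f)"
  by (rule Plus_eq_NullD) (use assms Comp_Plus_distrib[of f "Neg C f" h] in auto)

lemma Neg_Comp [simp]:
  assumes "f \<in> Arr C" "h \<in> Arr C" "Dom C f = Cod C h"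
  shows "Neg C f \<cdot> h = Neg C (f \<cdot> h)"
  by (rule Plus_eq_NullD) (use assms Plus_Comp_distrib[of f "Neg C f" h] in auto)

lemma Neg_Neg [simp]: "f \<in> Arr C \<Longrightarrow> Neg C (Neg C f) = f"
  by (rule Plus_eq_NullD[symmetric]) (auto simp: Plus_commute[of "Neg C f" f])

lemma Neg_Null [simp]: "X \<in> Obj C \<Longrightarrow> Y \<in> Obj C \<Longrightarrow> Neg C (Null C X Y) = Null C X Y"
  by (rule Plus_eq_NullD[symmetric]) auto

lemma Minus_self_plus:
  assumes "f \<in> Arr C" "g \<in> Arr C" "Dom C g = Dom C f" "Cod C g = Cod C f"
  shows "Plus C g (Minus C f g) = f"
proof -
  have "Plus C g (Minus C f g) = Plus C (Minus C f g) g" using assms by (simp add: Plus_commute)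
  also have "\<dots> = Plus C f (Plus C (Neg C g) g)" by (rule Plus_assoc) (use assms in simp_all)
  also have "\<dots> = f" using assms by (simp add: Plus_commute[of "Neg C g" g])
  finally show ?thesis .
qed

text \<open>The inverse of \<open>1 + n\<close> is the finite geometric series
  \<open>1 - n + n^2\<close>, which is \<open>z\<close> in the proof.\<close>

lemma is_iso_unipotent:
  assumes \<theta>: "\<theta> \<in> Hom C X X" and n: "n = Minus C \<theta> (Id C X)" and nil: "n \<cdot> (n \<cdot> n) = Null C X X"
  shows "is_iso C \<theta>"
proof -
  have X [simp]: "X \<in> Obj C" using \<theta> by auto
  have n' [simp]: "n \<in> Arr C" "Dom C n = X" "Cod C n = X" using n \<theta> by simp_all
  have \<theta>n: "\<theta> = Plus C (Id C X) n" using \<theta> n Minus_self_plus by simp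
  define y where "y = Minus C n (n \<cdot> n)"
  have y [simp]: "y \<in> Arr C" "Dom C y = X" "Cod C y = X" by (simp_all add: y_def)
  define z where "z = Minus C (Id C X) y"
  have z [simp]: "z \<in> Arr C" "Dom C z = X" "Cod C z = X" by (simp_all add: z_def)
  have ny: "n \<cdot> y = n \<cdot> n" "y \<cdot> n = n \<cdot> n"
    by (simp_all add: y_def Comp_Plus_distrib Plus_Comp_distrib nil)
  have *: "Plus C z (Minus C n (n \<cdot> n)) = Id C X"
    unfolding y_def[symmetric] z_def by (simp add: Plus_assoc Plus_commute[of "Neg C y" y])
  have "\<theta> \<cdot> z = Plus C z (n \<cdot> z)" by (simp add: \<theta>n Plus_Comp_distrib)
  also have "n \<cdot> z = Minus C n (n \<cdot> n)" by (simp add: z_def Comp_Plus_distrib ny)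
  finally have 1: "\<theta> \<cdot> z = Id C X" using * by simp
  have "z \<cdot> \<theta> = Plus C z (z \<cdot> n)" by (simp add: \<theta>n Comp_Plus_distrib)
  also have "z \<cdot> n = Minus C n (n \<cdot> n)" by (simp add: z_def Plus_Comp_distrib ny)
  finally have 2: "z \<cdot> \<theta> = Id C X" using * by simp
  show ?thesis by (rule is_isoI[OF \<theta> _ 2 1]) simp
qed

lemma zero_object_Null:
  assumes "zero_object C Z"
  shows "f \<in> Hom C X Z \<Longrightarrow> f = Null C X Z" "g \<in> Hom C Z X \<Longrightarrow> g = Null C Z X"
proof -
  have Z: "Z \<in> Obj C" using assms by (simp add: zero_object_def)
  show "f = Null C X Z" if "f \<in> Hom C X Z"
  proof -
    have X: "X \<in> Obj C" using that by auto
    have "\<exists>!h. h \<in> Hom C X Z" using assms X unfolding zero_object_def by blast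
    moreover have "Null C X Z \<in> Hom C X Z" using X Z by simp
    ultimately show ?thesis using that by blast
  qed
  show "g = Null C Z X" if "g \<in> Hom C Z X"
  proof -
    have X: "X \<in> Obj C" using that by auto
    have "\<exists>!h. h \<in> Hom C Z X" using assms X unfolding zero_object_def by blast
    moreover have "Null C Z X \<in> Hom C Z X" using X Z by simp
    ultimately show ?thesis using that by blast
  qed
qed

text \<open>In this equational form, preservation under additive functors is immediate.\<close>

lemma zero_object_iff: "zero_object C Z \<longleftrightarrow> Z \<in> Obj C \<and> Id C Z = Null C Z Z"
proof
  assume z: "zero_object C Z"
  then have "Z \<in> Obj C" by (simp add: zero_object_def)
  with zero_object_Null(1)[OF z, of "Id C Z" Z] show "Z \<in> Obj C \<and> Id C Z = Null C Z Z" by simp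
next
  assume Z: "Z \<in> Obj C \<and> Id C Z = Null C Z Z"
  have "f = Null C X Z" if "f \<in> Hom C X Z" for f X
    using that Z Id_Comp[of f Z] Null_Comp[of f Z Z] by simp
  moreover have "f = Null C Z X" if "f \<in> Hom C Z X" for f X
    using that Z Comp_Id[of f Z] Comp_Null[of f Z Z] by simp
  ultimately show "zero_object C Z" unfolding zero_object_def using Z
    by (metis Null_simps in_Hom)
qed

text \<open>Lets a result stated for the projection to the first summand be applied to the
  second.\<close>

lemma biproduct_swap:
  assumes "biproduct C X Y B i1 i2 p1 p2"
  shows "biproduct C Y X B i2 i1 p2 p1"
  using assms Plus_commute[of "i1 \<cdot> p1" "i2 \<cdot> p2"] unfolding biproduct_def by auto

end

section \<open>Functors and additive functors\<close>

context functor_between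
begin

lemma omap_Obj' [simp]: "X \<in> Obj C \<Longrightarrow> omap F X \<in> Obj D"
  by (rule omap_Obj)

lemma amap_simps [simp]:
  assumes "f \<in> Arr C"
  shows "amap F f \<in> Arr D" "Dom D (amap F f) = omap F (Dom C f)"
    "Cod D (amap F f) = omap F (Cod C f)"
  using amap_Hom[of f "Dom C f" "Cod C f"] assms by simp_all

lemma amap_Id' [simp]: "X \<in> Obj C \<Longrightarrow> amap F (Id C X) = Id D (omap F X)"
  by (rule amap_Id)

lemma amap_Comp':
  assumes "f \<in> Arr C" "g \<in> Arr C" "Dom C g = Cod C f"
  shows "amap F (g \<cdot>\<^bsub>C\<^esub> f) = amap F g \<cdot>\<^bsub>D\<^esub> amap F f"
  using amap_Comp[of f "Dom C f" "Cod C f" g "Cod C g"] assms by simp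

end

context additive_functor
begin

lemma amap_Plus':
  assumes "f \<in> Arr C" "g \<in> Arr C" "Dom C g = Dom C f" "Cod C g = Cod C f"
  shows "amap F (Plus C f g) = Plus D (amap F f) (amap F g)"
  using amap_Plus[of f "Dom C f" "Cod C f" g] assms by simp

lemma amap_Null [simp]:
  assumes "X \<in> Obj C" "Y \<in> Obj C"
  shows "amap F (Null C X Y) = Null D (omap F X) (omap F Y)"
proof -
  have "Plus D (amap F (Null C X Y)) (amap F (Null C X Y)) = amap F (Null C X Y)"
    using assms by (simp flip: amap_Plus')
  from target.Plus_idem_Null[OF this] show ?thesis using assms by simp
qed

lemma amap_Neg [simp]: "f \<in> Arr C \<Longrightarrow> amap F (Neg C f) = Neg D (amap F f)"
  by (rule target.Plus_eq_NullD) (auto simp flip: amap_Plus')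

lemma amap_zero_object: "zero_object C Z \<Longrightarrow> zero_object D (omap F Z)"
  unfolding source.zero_object_iff target.zero_object_iff
  by (metis amap_Id' amap_Null omap_Obj')

lemma amap_biproduct:
  assumes "biproduct C X Y B i1 i2 p1 p2"
  shows "biproduct D (omap F X) (omap F Y) (omap F B) (amap F i1) (amap F i2) (amap F p1) (amap F p2)"
proof -
  have X: "X \<in> Obj C" "Y \<in> Obj C" "B \<in> Obj C" using assms by (auto simp: biproduct_def)
  show ?thesis using assms X unfolding biproduct_def
    by (simp flip: amap_Comp' amap_Plus')
qed

end


section \<open>Distinguished triangles\<close>

context pretriangulated_category
begin

lemma dist_simps:
  assumes "(u, v, w) \<in> T"
  shows "u \<in> Arr C" "v \<in> Arr C" "w \<in> Arr C"
    "Dom C v = Cod C u" "Dom C w = Cod C v" "Cod C w = omap S (Dom C u)"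
    "v \<cdot>\<^bsub>C\<^esub> u = Null C (Dom C u) (Cod C v)" "w \<cdot>\<^bsub>C\<^esub> v = Null C (Cod C u) (omap S (Dom C u))"
    "amap S u \<cdot>\<^bsub>C\<^esub> w = Null C (Cod C v) (omap S (Cod C u))"
  using distinguished_candidate[OF assms] unfolding candidate_triangle_def by auto

lemma dist_rotate: "(u, v, w) \<in> T \<Longrightarrow> (v, w, Neg C (amap S u)) \<in> T"
  using TR2 distinguished_candidate unfolding TR2_def by blast

lemma dist_rotate_back:
  "(v, w, Neg C (amap S u)) \<in> T \<Longrightarrow> candidate_triangle C S (u, v, w) \<Longrightarrow> (u, v, w) \<in> T"
  using TR2 unfolding TR2_def by blast

lemma ex_dist: "u \<in> Arr C \<Longrightarrow> \<exists>v w. (u, v, w) \<in> T"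
  using TR1 unfolding TR1_def by blast

lemma dist_extend:
  assumes "(u, v, w) \<in> T" "(u', v', w') \<in> T"
    and "f \<in> Hom C (Dom C u) (Dom C u')" "g \<in> Hom C (Cod C u) (Cod C u')"
    and "g \<cdot>\<^bsub>C\<^esub> u = u' \<cdot>\<^bsub>C\<^esub> f"
  obtains h where "h \<in> Hom C (Cod C v) (Cod C v')"
    "h \<cdot>\<^bsub>C\<^esub> v = v' \<cdot>\<^bsub>C\<^esub> g" "w' \<cdot>\<^bsub>C\<^esub> h = amap S f \<cdot>\<^bsub>C\<^esub> w"
proof -
  obtain h where "triangle_morphism C S (u, v, w) (u', v', w') f g h"
    using TR3 assms unfolding TR3_def by blast
  then show thesis using that[of h] dist_simps[OF assms(1)] dist_simps[OF assms(2)]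
    by (simp add: triangle_morphism_def)
qed

text \<open>TR1 closes the distinguished triangles under isomorphism only among candidate triangles.
  The three vanishing composites are therefore carried over first, by composing with
  \<open>f\<close>, \<open>g\<close>, \<open>h\<close> and cancelling them.\<close>

lemma dist_iso:
  assumes t: "(u, v, w) \<in> T"
    and u': "u' \<in> Hom C X Y" and v': "v' \<in> Hom C Y Z" and w': "w' \<in> Hom C Z (omap S X)"
    and f: "f \<in> Hom C (Dom C u) X" "is_iso C f" and g: "g \<in> Hom C (Cod C u) Y" "is_iso C g"
    and h: "h \<in> Hom C (Cod C v) Z" "is_iso C h"
    and gu: "g \<cdot>\<^bsub>C\<^esub> u = u' \<cdot>\<^bsub>C\<^esub> f" and hv: "h \<cdot>\<^bsub>C\<^esub> v = v' \<cdot>\<^bsub>C\<^esub> g"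
    and wh: "w' \<cdot>\<^bsub>C\<^esub> h = amap S f \<cdot>\<^bsub>C\<^esub> w"
  shows "(u', v', w') \<in> T"
proof -
  note [simp] = dist_simps[OF t]
  have XYZ: "X \<in> Obj C" "Y \<in> Obj C" "Z \<in> Obj C" using u' v' by auto
  have [simp]: "u' \<in> Arr C" "v' \<in> Arr C" "w' \<in> Arr C" "f \<in> Arr C" "g \<in> Arr C" "h \<in> Arr C"
    "Dom C u' = X" "Cod C u' = Y" "Dom C v' = Y" "Cod C v' = Z" "Dom C w' = Z" "Cod C w' = omap S X"
    "Dom C f = Dom C u" "Cod C f = X" "Dom C g = Cod C u" "Cod C g = Y"
    "Dom C h = Cod C v" "Cod C h = Z"
    using u' v' w' f g h by simp_all
  have 1: "v' \<cdot>\<^bsub>C\<^esub> u' = Null C X Z"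
  proof (rule source.Comp_cancel_iso[OF f(2)])
    have "(v' \<cdot>\<^bsub>C\<^esub> u') \<cdot>\<^bsub>C\<^esub> f = v' \<cdot>\<^bsub>C\<^esub> (g \<cdot>\<^bsub>C\<^esub> u)" by (simp add: gu)
    also have "\<dots> = h \<cdot>\<^bsub>C\<^esub> (v \<cdot>\<^bsub>C\<^esub> u)"
      by (rule source.Comp_reduce[OF hv[symmetric], THEN trans]) simp_all
    also have "\<dots> = Null C X Z \<cdot>\<^bsub>C\<^esub> f" using XYZ by simp
    finally show "(v' \<cdot>\<^bsub>C\<^esub> u') \<cdot>\<^bsub>C\<^esub> f = Null C X Z \<cdot>\<^bsub>C\<^esub> f" .
  qed (use XYZ in simp_all)
  have 2: "w' \<cdot>\<^bsub>C\<^esub> v' = Null C Y (omap S X)"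
  proof (rule source.Comp_cancel_iso[OF g(2)])
    have "(w' \<cdot>\<^bsub>C\<^esub> v') \<cdot>\<^bsub>C\<^esub> g = w' \<cdot>\<^bsub>C\<^esub> (h \<cdot>\<^bsub>C\<^esub> v)" by (simp add: hv)
    also have "\<dots> = amap S f \<cdot>\<^bsub>C\<^esub> (w \<cdot>\<^bsub>C\<^esub> v)"
      by (rule source.Comp_reduce[OF wh, THEN trans]) simp_all
    also have "\<dots> = Null C Y (omap S X) \<cdot>\<^bsub>C\<^esub> g" using XYZ by simp
    finally show "(w' \<cdot>\<^bsub>C\<^esub> v') \<cdot>\<^bsub>C\<^esub> g = Null C Y (omap S X) \<cdot>\<^bsub>C\<^esub> g" .
  qed (use XYZ in simp_all)
  have 3: "amap S u' \<cdot>\<^bsub>C\<^esub> w' = Null C Z (omap S Y)"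
  proof (rule source.Comp_cancel_iso[OF h(2)])
    have "(amap S u' \<cdot>\<^bsub>C\<^esub> w') \<cdot>\<^bsub>C\<^esub> h = amap S (u' \<cdot>\<^bsub>C\<^esub> f) \<cdot>\<^bsub>C\<^esub> w" by (simp add: wh amap_Comp')
    also have "\<dots> = amap S g \<cdot>\<^bsub>C\<^esub> (amap S u \<cdot>\<^bsub>C\<^esub> w)"
      unfolding gu[symmetric] by (simp add: amap_Comp' del: dist_simps(9)[OF t])
    also have "\<dots> = Null C Z (omap S Y) \<cdot>\<^bsub>C\<^esub> h" using XYZ by simp
    finally show "(amap S u' \<cdot>\<^bsub>C\<^esub> w') \<cdot>\<^bsub>C\<^esub> h = Null C Z (omap S Y) \<cdot>\<^bsub>C\<^esub> h" .
  qed (use XYZ in simp_all)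
  have "candidate_triangle C S (u', v', w')"
    unfolding candidate_triangle_def using XYZ 1 2 3 by auto
  moreover have "triangle_morphism C S (u, v, w) (u', v', w') f g h"
    unfolding triangle_morphism_def using gu hv wh by simp
  then have "triangle_isomorphic C S (u, v, w) (u', v', w')"
    unfolding triangle_isomorphic_def using f(2) g(2) h(2) by blast
  ultimately show ?thesis using TR1 t unfolding TR1_def by blast
qed

text \<open>Rotating this triangle gives the identity triangle of \<open>P\<close>, with the
  suspension of \<open>Z\<close> as zero object; the sign from rotation falls on a zero map. It is
  the target of the extension in \<open>dist_factor\<close>.\<close>

lemma dist_zero_Id:
  assumes Z: "zero_object C Z" and P: "P \<in> Obj C"
  shows "(Null C Z P, Id C P, Null C P (omap S Z)) \<in> T"
proof (rule dist_rotate_back)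
  have Z': "Z \<in> Obj C" using Z by (simp add: zero_object_def)
  have SZ: "zero_object C (omap S Z)" by (rule amap_zero_object[OF Z])
  have "(Id C P, Null C P (omap S Z), Null C (omap S Z) (omap S P)) \<in> T"
    using TR1 P SZ unfolding TR1_def by blast
  then show "(Id C P, Null C P (omap S Z), Neg C (amap S (Null C Z P))) \<in> T" using P Z' by simp
  show "candidate_triangle C S (Null C Z P, Id C P, Null C P (omap S Z))"
    unfolding candidate_triangle_def using P Z' by auto
qed

text \<open>\<open>v\<close> is a weak cokernel of \<open>u\<close>: by TR3 the square with sides
  \<open>u\<close> and \<open>0 -> P\<close> extends to a morphism into the triangle
  \<open>0 -> P -> P\<close>, and its third component is the factorisation.\<close>

lemma dist_factor:
  assumes t: "(u, v, w) \<in> T" and h: "h \<in> Hom C (Cod C u) P"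
    and hu: "h \<cdot>\<^bsub>C\<^esub> u = Null C (Dom C u) P"
  obtains h' where "h' \<in> Hom C (Cod C v) P" "h = h' \<cdot>\<^bsub>C\<^esub> v"
proof -
  note [simp] = dist_simps[OF t]
  have P: "P \<in> Obj C" using h by auto
  obtain Z where Z: "zero_object C Z" using source.ex_zero_object by blast
  then have Z': "Z \<in> Obj C" by (simp add: zero_object_def)
  obtain h' where "h' \<in> Hom C (Cod C v) (Cod C (Id C P))" "h' \<cdot>\<^bsub>C\<^esub> v = Id C P \<cdot>\<^bsub>C\<^esub> h"
    by (rule dist_extend[OF t dist_zero_Id[OF Z P], of "Null C (Dom C u) Z" h])
      (use h hu P Z' in simp_all)
  then show thesis using that[of h'] h P by simp
qed

text \<open>One rotation further: maps that vanish on \<open>v\<close> factor through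
  \<open>w\<close>.\<close>

lemmas dist_factor_connecting = dist_factor[OF dist_rotate]

text \<open>\<open>n = \<theta> - 1\<close> vanishes on \<open>v\<close>, so it factors as
  \<open>n' \<cdot> w\<close>; since also \<open>w \<cdot> n = 0\<close>, this gives
  \<open>n^2 = 0\<close>. The lemma takes the place of the five lemma.\<close>

lemma dist_endo_iso:
  assumes t: "(u, v, w) \<in> T" and \<theta>: "\<theta> \<in> Hom C (Cod C v) (Cod C v)"
    and \<theta>v: "\<theta> \<cdot>\<^bsub>C\<^esub> v = v" and w\<theta>: "w \<cdot>\<^bsub>C\<^esub> \<theta> = w"
  shows "is_iso C \<theta>"
proof -
  note [simp] = dist_simps[OF t]
  let ?Z = "Cod C v"
  define n where "n = Minus C \<theta> (Id C ?Z)"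
  have n: "n \<in> Hom C ?Z ?Z" using \<theta> by (simp add: n_def)
  have nv: "n \<cdot>\<^bsub>C\<^esub> v = Null C (Cod C u) ?Z" using \<theta> \<theta>v by (simp add: n_def source.Plus_Comp_distrib)
  have wn: "w \<cdot>\<^bsub>C\<^esub> n = Null C ?Z (omap S (Dom C u))"
    using \<theta> w\<theta> by (simp add: n_def source.Comp_Plus_distrib)
  obtain n' where n': "n' \<in> Hom C (Cod C w) ?Z" "n = n' \<cdot>\<^bsub>C\<^esub> w"
    by (rule dist_factor_connecting[OF t, of n ?Z]) (use n nv in simp_all)
  have "n \<cdot>\<^bsub>C\<^esub> n = (n' \<cdot>\<^bsub>C\<^esub> w) \<cdot>\<^bsub>C\<^esub> n" by (simp flip: n'(2))
  also have "\<dots> = Null C ?Z ?Z" using n n'(1) wn by simp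
  finally have "n \<cdot>\<^bsub>C\<^esub> (n \<cdot>\<^bsub>C\<^esub> n) = Null C ?Z ?Z" using n by simp
  then show ?thesis by (rule source.is_iso_unipotent[OF \<theta> n_def])
qed

text \<open>TR3 extends the identities in both directions, and \<open>dist_endo_iso\<close> makes
  both composites of the two extensions invertible.\<close>

lemma cone_unique:
  assumes t: "(u, v, w) \<in> T" and t': "(u, v', w') \<in> T"
  obtains h where "h \<in> Hom C (Cod C v) (Cod C v')" "is_iso C h" "h \<cdot>\<^bsub>C\<^esub> v = v'" "w' \<cdot>\<^bsub>C\<^esub> h = w"
proof -
  note [simp] = dist_simps[OF t] dist_simps[OF t']
  obtain h where h: "h \<in> Hom C (Cod C v) (Cod C v')" "h \<cdot>\<^bsub>C\<^esub> v = v'" "w' \<cdot>\<^bsub>C\<^esub> h = w"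
    by (rule dist_extend[OF t t', of "Id C (Dom C u)" "Id C (Cod C u)"]) simp_all
  obtain k where k: "k \<in> Hom C (Cod C v') (Cod C v)" "k \<cdot>\<^bsub>C\<^esub> v' = v" "w \<cdot>\<^bsub>C\<^esub> k = w'"
    by (rule dist_extend[OF t' t, of "Id C (Dom C u)" "Id C (Cod C u)"]) simp_all
  have "is_iso C (k \<cdot>\<^bsub>C\<^esub> h)"
    by (rule dist_endo_iso[OF t]) (use h k source.Comp_reduce[OF k(3), of h] in simp_all)
  moreover have "is_iso C (h \<cdot>\<^bsub>C\<^esub> k)"
    by (rule dist_endo_iso[OF t']) (use h k source.Comp_reduce[OF h(3), of k] in simp_all)
  ultimately have "is_iso C h" using source.is_iso_both_composites h(1) k(1) by blast
  with h that show thesis by blast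
qed

text \<open>The cone \<open>?V\<close> of \<open>iB\<close> is identified with \<open>A\<close>:
  \<open>pA\<close> factors through it by \<open>s\<close>, and \<open>x = y \<cdot> iA\<close>
  satisfies \<open>s \<cdot> x = 1\<close>. That \<open>x \<cdot> s\<close> is invertible comes from
  \<open>dist_endo_iso\<close>.\<close>

lemma dist_split:
  assumes bp: "biproduct C A B M iA iB pA pB"
  shows "(iB, pA, Null C A (omap S B)) \<in> T"
proof -
  have bpD [simp]: "M \<in> Obj C" "iA \<in> Arr C" "iB \<in> Arr C" "pA \<in> Arr C" "pB \<in> Arr C"
    "Dom C iA = A" "Dom C iB = B" "Cod C iA = M" "Cod C iB = M"
    "Dom C pA = M" "Dom C pB = M" "Cod C pA = A" "Cod C pB = B"
    "pA \<cdot>\<^bsub>C\<^esub> iA = Id C A" "pB \<cdot>\<^bsub>C\<^esub> iB = Id C B" "pA \<cdot>\<^bsub>C\<^esub> iB = Null C B A"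
    "Plus C (iA \<cdot>\<^bsub>C\<^esub> pA) (iB \<cdot>\<^bsub>C\<^esub> pB) = Id C M"
    using bp unfolding biproduct_def by auto
  have AB [simp]: "A \<in> Obj C" "B \<in> Obj C"
    using source.Dom_Obj[of iA] source.Dom_Obj[of iB] by simp_all
  obtain y z where t: "(iB, y, z) \<in> T" using ex_dist[of iB] by auto
  note [simp] = dist_simps[OF t, simplified]
  let ?V = "Cod C y"
  have V: "?V \<in> Obj C" by simp
  \<comment> \<open>\<open>amap S pB\<close> is a left inverse of \<open>amap S iB\<close>, so
    \<open>amap S iB \<cdot> z = 0\<close> forces \<open>z = 0\<close>.\<close>
  have "amap S pB \<cdot>\<^bsub>C\<^esub> (amap S iB \<cdot>\<^bsub>C\<^esub> z) = z"
    using source.Comp_reduce[of "amap S pB" "amap S iB" "Id C (omap S B)" z]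
    by (simp del: dist_simps(9)[OF t, simplified] flip: amap_Comp')
  then have z: "z = Null C ?V (omap S B)" by simp
  obtain s where s: "s \<in> Hom C ?V A" "pA = s \<cdot>\<^bsub>C\<^esub> y"
    by (rule dist_factor[OF t, of pA A]) simp_all
  define x where "x = y \<cdot>\<^bsub>C\<^esub> iA"
  have x: "x \<in> Hom C A ?V" by (simp add: x_def)
  have sx: "s \<cdot>\<^bsub>C\<^esub> x = Id C A"
    using s(1) source.Comp_reduce[OF s(2)[symmetric], of iA] by (simp add: x_def)
  \<comment> \<open>\<open>y\<close> vanishes on \<open>iB\<close>, so splitting the identity of
    \<open>M\<close> leaves only the summand through \<open>iA\<close>, which is
    \<open>x \<cdot> s \<cdot> y\<close>.\<close>
  have "y = y \<cdot>\<^bsub>C\<^esub> Plus C (iA \<cdot>\<^bsub>C\<^esub> pA) (iB \<cdot>\<^bsub>C\<^esub> pB)" by simp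
  also have "\<dots> = Plus C (y \<cdot>\<^bsub>C\<^esub> (iA \<cdot>\<^bsub>C\<^esub> pA)) (y \<cdot>\<^bsub>C\<^esub> (iB \<cdot>\<^bsub>C\<^esub> pB))"
    by (rule source.Comp_Plus_distrib) simp_all
  also have "y \<cdot>\<^bsub>C\<^esub> (iB \<cdot>\<^bsub>C\<^esub> pB) = Null C M ?V"
    by (rule source.Comp_reduce[OF dist_simps(7)[OF t], THEN trans]) simp_all
  also have "y \<cdot>\<^bsub>C\<^esub> (iA \<cdot>\<^bsub>C\<^esub> pA) = (x \<cdot>\<^bsub>C\<^esub> s) \<cdot>\<^bsub>C\<^esub> y"
    using s(1) by (simp add: x_def flip: s(2))
  finally have xsy: "(x \<cdot>\<^bsub>C\<^esub> s) \<cdot>\<^bsub>C\<^esub> y = y" using s(1) x by simp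
  have "is_iso C (x \<cdot>\<^bsub>C\<^esub> s)"
    by (rule dist_endo_iso[OF t]) (use s(1) x xsy z in simp_all)
  moreover have "is_iso C (s \<cdot>\<^bsub>C\<^esub> x)" using source.is_iso_Id[of A] sx by simp
  ultimately have "is_iso C s" using source.is_iso_both_composites s(1) x by blast
  then show ?thesis
    by (intro dist_iso[OF t, of iB B M pA A _ "Id C B" "Id C M" s])
      (use s z source.is_iso_Id in simp_all)
qed

text \<open>With \<open>n = \<theta> - 1\<close>, both \<open>n - \<mu> \<cdot> x\<close> and \<open>x \<cdot> n\<close> factor through \<open>w\<close>, whence \<open>n\<^sup>2 = \<mu> \<cdot> x \<cdot> n\<close> and \<open>n\<^sup>3 = 0\<close>.\<close>

lemma dist_endo_iso_of_factor:
  assumes t: "(u, v, w) \<in> T" and \<theta>: "\<theta> \<in> Hom C (Cod C v) (Cod C v)"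
    and x: "x \<in> Hom C (Cod C v) R" and \<mu>: "\<mu> \<in> Hom C R (Cod C v)"
    and w\<theta>: "w \<cdot>\<^bsub>C\<^esub> \<theta> = w" and x\<theta>v: "x \<cdot>\<^bsub>C\<^esub> (\<theta> \<cdot>\<^bsub>C\<^esub> v) = x \<cdot>\<^bsub>C\<^esub> v"
    and \<theta>v: "Minus C (\<theta> \<cdot>\<^bsub>C\<^esub> v) v = \<mu> \<cdot>\<^bsub>C\<^esub> (x \<cdot>\<^bsub>C\<^esub> v)"
  shows "is_iso C \<theta>"
proof -
  note [simp] = dist_simps[OF t]
  let ?Z = "Cod C v" and ?SX = "omap S (Dom C u)"
  have R [simp]: "R \<in> Obj C" using x by auto
  have [simp]: "\<theta> \<in> Arr C" "Dom C \<theta> = ?Z" "Cod C \<theta> = ?Z" "x \<in> Arr C" "Dom C x = ?Z" "Cod C x = R"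
    "\<mu> \<in> Arr C" "Dom C \<mu> = R" "Cod C \<mu> = ?Z" using \<theta> x \<mu> by auto
  define n where "n = Minus C \<theta> (Id C ?Z)"
  have n [simp]: "n \<in> Arr C" "Dom C n = ?Z" "Cod C n = ?Z" by (simp_all add: n_def)
  have nv: "n \<cdot>\<^bsub>C\<^esub> v = (\<mu> \<cdot>\<^bsub>C\<^esub> x) \<cdot>\<^bsub>C\<^esub> v" using \<theta>v by (simp add: n_def source.Plus_Comp_distrib)
  have wn: "w \<cdot>\<^bsub>C\<^esub> n = Null C ?Z ?SX" using w\<theta> by (simp add: n_def source.Comp_Plus_distrib)
  have xnv: "(x \<cdot>\<^bsub>C\<^esub> n) \<cdot>\<^bsub>C\<^esub> v = Null C (Cod C u) R"
    using x\<theta>v by (simp add: n_def source.Comp_Plus_distrib source.Plus_Comp_distrib)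
  obtain l where l: "l \<in> Hom C ?SX R" "x \<cdot>\<^bsub>C\<^esub> n = l \<cdot>\<^bsub>C\<^esub> w"
    by (rule dist_factor_connecting[OF t, of "x \<cdot>\<^bsub>C\<^esub> n" R]) (use xnv in simp_all)
  define d where "d = Minus C n (\<mu> \<cdot>\<^bsub>C\<^esub> x)"
  have d [simp]: "d \<in> Arr C" "Dom C d = ?Z" "Cod C d = ?Z" by (simp_all add: d_def)
  have "d \<cdot>\<^bsub>C\<^esub> v = Null C (Cod C u) ?Z" using nv by (simp add: d_def source.Plus_Comp_distrib)
  then obtain k where k: "k \<in> Hom C ?SX ?Z" "d = k \<cdot>\<^bsub>C\<^esub> w"
    using dist_factor_connecting[OF t, of d ?Z] by auto
  have "d \<cdot>\<^bsub>C\<^esub> n = Null C ?Z ?Z" unfolding k(2) using k(1) wn by simp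
  moreover have "n = Plus C (\<mu> \<cdot>\<^bsub>C\<^esub> x) d" unfolding d_def by (rule source.Minus_self_plus[symmetric]) simp_all
  then have "n \<cdot>\<^bsub>C\<^esub> n = Plus C (\<mu> \<cdot>\<^bsub>C\<^esub> x) d \<cdot>\<^bsub>C\<^esub> n" by simp
  then have "n \<cdot>\<^bsub>C\<^esub> n = Plus C ((\<mu> \<cdot>\<^bsub>C\<^esub> x) \<cdot>\<^bsub>C\<^esub> n) (d \<cdot>\<^bsub>C\<^esub> n)"
    by (simp add: source.Plus_Comp_distrib)
  ultimately have nn: "n \<cdot>\<^bsub>C\<^esub> n = \<mu> \<cdot>\<^bsub>C\<^esub> (x \<cdot>\<^bsub>C\<^esub> n)" by simp
  have "n \<cdot>\<^bsub>C\<^esub> (n \<cdot>\<^bsub>C\<^esub> n) = (n \<cdot>\<^bsub>C\<^esub> n) \<cdot>\<^bsub>C\<^esub> n" by simp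
  also have "\<dots> = \<mu> \<cdot>\<^bsub>C\<^esub> ((x \<cdot>\<^bsub>C\<^esub> n) \<cdot>\<^bsub>C\<^esub> n)" unfolding nn by simp
  also have "(x \<cdot>\<^bsub>C\<^esub> n) \<cdot>\<^bsub>C\<^esub> n = Null C ?Z R" unfolding l(2) using l(1) wn by simp
  finally have "n \<cdot>\<^bsub>C\<^esub> (n \<cdot>\<^bsub>C\<^esub> n) = Null C ?Z ?Z" by simp
  then show ?thesis by (rule source.is_iso_unipotent[OF \<theta> n_def])
qed

end

section \<open>Cones of maps into a biproduct, in a triangulated category\<close>

context triangulated_category
begin

text \<open>
  The octahedral axiom for the composite of \<open>f\<close> with the split epimorphism \<open>pA\<close>, whose cone is the
  suspension of \<open>B\<close>.
\<close>

lemma cone_into_biproduct: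
  assumes bp: "biproduct C A B M iA iB pA pB"
    and t: "(f, b, c) \<in> T" and f: "f \<in> Hom C Y M" and t': "(pA \<cdot>\<^bsub>C\<^esub> f, a, a') \<in> T"
  obtains q where "q \<in> Hom C (Cod C b) (Cod C a)" "q \<cdot>\<^bsub>C\<^esub> b = a \<cdot>\<^bsub>C\<^esub> pA" "a' \<cdot>\<^bsub>C\<^esub> q = c"
    "(b \<cdot>\<^bsub>C\<^esub> iB, q, Neg C (amap S (pB \<cdot>\<^bsub>C\<^esub> f) \<cdot>\<^bsub>C\<^esub> a')) \<in> T"
proof -
  have [simp]: "M \<in> Obj C" "iB \<in> Arr C" "pA \<in> Arr C" "pB \<in> Arr C"
    "Dom C iB = B" "Cod C iB = M" "Dom C pA = M" "Dom C pB = M" "Cod C pA = A" "Cod C pB = B"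
    "pB \<cdot>\<^bsub>C\<^esub> iB = Id C B" "pA \<cdot>\<^bsub>C\<^esub> iB = Null C B A"
    using bp unfolding biproduct_def by auto
  have AB [simp]: "A \<in> Obj C" "B \<in> Obj C"
    using source.Cod_Obj[of pA] source.Dom_Obj[of iB] by simp_all
  have [simp]: "f \<in> Arr C" "Dom C f = Y" "Cod C f = M" using f by simp_all
  have [simp]: "Y \<in> Obj C" using source.Dom_Obj[of f] by simp
  note [simp] = dist_simps[OF t, simplified] dist_simps[OF t', simplified]
  let ?W = "Cod C b" and ?A1 = "Cod C a"
  have split: "(pA, Null C A (omap S B), Neg C (amap S iB)) \<in> T"
    by (rule dist_rotate[OF dist_split[OF bp]])
  \<comment> \<open>TR4 for \<open>f\<close> followed by \<open>pA\<close>: \<open>b\<close>,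
    \<open>c\<close> belong to the cone of \<open>f\<close>, the suspension of \<open>B\<close> is
    the cone of \<open>pA\<close>, and \<open>a\<close>, \<open>a'\<close> belong to the cone of the
    composite. The map \<open>s\<close> it yields is not yet explicit.\<close>
  have "\<exists>q \<in> Hom C ?W ?A1. \<exists>s \<in> Hom C ?A1 (omap S B).
      q \<cdot>\<^bsub>C\<^esub> b = a \<cdot>\<^bsub>C\<^esub> pA \<and> s \<cdot>\<^bsub>C\<^esub> a = Null C A (omap S B) \<and> a' \<cdot>\<^bsub>C\<^esub> q = c \<and>
      Neg C (amap S iB) \<cdot>\<^bsub>C\<^esub> s = amap S f \<cdot>\<^bsub>C\<^esub> a' \<and>
      (q, s, amap S b \<cdot>\<^bsub>C\<^esub> Neg C (amap S iB)) \<in> T"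
    by (rule TR4[unfolded TR4_def, rule_format, of f Y M b ?W c pA A _ "omap S B" _ a ?A1 a'])
      (use t t' split in simp_all)
  then obtain q s where q: "q \<in> Hom C ?W ?A1" and s: "s \<in> Hom C ?A1 (omap S B)"
    and qb: "q \<cdot>\<^bsub>C\<^esub> b = a \<cdot>\<^bsub>C\<^esub> pA" and a'q: "a' \<cdot>\<^bsub>C\<^esub> q = c"
    and iBs: "Neg C (amap S iB) \<cdot>\<^bsub>C\<^esub> s = amap S f \<cdot>\<^bsub>C\<^esub> a'"
    and tq: "(q, s, amap S b \<cdot>\<^bsub>C\<^esub> Neg C (amap S iB)) \<in> T" by blast
  note [simp] = q[simplified] s[simplified]
  have iBs': "amap S iB \<cdot>\<^bsub>C\<^esub> s = Neg C (amap S f \<cdot>\<^bsub>C\<^esub> a')"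
    unfolding iBs[symmetric] by simp
  \<comment> \<open>Composing with the left inverse \<open>amap S pB\<close> of
    \<open>amap S iB\<close> determines \<open>s\<close>.\<close>
  have "amap S pB \<cdot>\<^bsub>C\<^esub> (amap S iB \<cdot>\<^bsub>C\<^esub> s) = s"
    using source.Comp_reduce[of "amap S pB" "amap S iB" "Id C (omap S B)" s]
    by (simp flip: amap_Comp')
  then have s_eq: "s = Neg C (amap S (pB \<cdot>\<^bsub>C\<^esub> f) \<cdot>\<^bsub>C\<^esub> a')" by (simp add: iBs' amap_Comp')
  have "(b \<cdot>\<^bsub>C\<^esub> iB, q, s) \<in> T"
  proof (rule dist_rotate_back)
    show "(q, s, Neg C (amap S (b \<cdot>\<^bsub>C\<^esub> iB))) \<in> T" using tq by (simp add: amap_Comp')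
    have "q \<cdot>\<^bsub>C\<^esub> (b \<cdot>\<^bsub>C\<^esub> iB) = Null C B ?A1"
      using source.Comp_reduce[OF qb, of iB] by simp
    moreover have "s \<cdot>\<^bsub>C\<^esub> q = Null C ?W (omap S B)" using dist_simps(7)[OF tq] by simp
    \<comment> \<open>The last composite of the candidate triangle is, up to sign, the suspension of
      \<open>b \<cdot> f = 0\<close> after \<open>a'\<close>.\<close>
    moreover have "amap S b \<cdot>\<^bsub>C\<^esub> (amap S f \<cdot>\<^bsub>C\<^esub> a') = Null C ?A1 (omap S ?W)"
      using source.Comp_reduce[of "amap S b" "amap S f" "Null C (omap S Y) (omap S ?W)" a']
      by (simp flip: amap_Comp')
    ultimately show "candidate_triangle C S (b \<cdot>\<^bsub>C\<^esub> iB, q, s)"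
      unfolding candidate_triangle_def by (simp add: amap_Comp' iBs')
  qed
  then show thesis using that[OF q qb a'q] s_eq by simp
qed

end

section \<open>Separable exact functors\<close>

context separable_functor
begin

text \<open>Taking an identity for one of the outer morphisms splits the two-sided naturality of
  \<open>H\<close> into one rule for each side.\<close>

lemma separable_retraction:
  obtains H where
    "\<And>X Y b. X \<in> Obj D \<Longrightarrow> Y \<in> Obj D \<Longrightarrow> b \<in> Hom C (omap F X) (omap F Y) \<Longrightarrow>
       H X Y b \<in> Hom D X Y"
    "\<And>X Y a. a \<in> Hom D X Y \<Longrightarrow> H X Y (amap F a) = a"
    "\<And>X X' Y a b. a \<in> Hom D X' X \<Longrightarrow> Y \<in> Obj D \<Longrightarrow> b \<in> Hom C (omap F X) (omap F Y) \<Longrightarrow>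
       H X' Y (b \<cdot>\<^bsub>C\<^esub> amap F a) = H X Y b \<cdot>\<^bsub>D\<^esub> a"
    "\<And>X Y Y' a b. a \<in> Hom D Y Y' \<Longrightarrow> X \<in> Obj D \<Longrightarrow> b \<in> Hom C (omap F X) (omap F Y) \<Longrightarrow>
       H X Y' (amap F a \<cdot>\<^bsub>C\<^esub> b) = a \<cdot>\<^bsub>D\<^esub> H X Y b"
proof -
  obtain H where hom: "\<And>X Y. X \<in> Obj D \<Longrightarrow> Y \<in> Obj D \<Longrightarrow>
        H X Y \<in> hom (hom_group C (omap F X) (omap F Y)) (hom_group D X Y)"
    and ret: "\<And>X Y a. X \<in> Obj D \<Longrightarrow> Y \<in> Obj D \<Longrightarrow> a \<in> Hom D X Y \<Longrightarrow> H X Y (amap F a) = a"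
    and nat: "\<And>X' X Y Y' u b v. X' \<in> Obj D \<Longrightarrow> X \<in> Obj D \<Longrightarrow> Y \<in> Obj D \<Longrightarrow> Y' \<in> Obj D \<Longrightarrow>
        u \<in> Hom D X' X \<Longrightarrow> b \<in> Hom C (omap F X) (omap F Y) \<Longrightarrow> v \<in> Hom D Y Y' \<Longrightarrow>
        H X' Y' (amap F v \<cdot>\<^bsub>C\<^esub> b \<cdot>\<^bsub>C\<^esub> amap F u) = v \<cdot>\<^bsub>D\<^esub> H X Y b \<cdot>\<^bsub>D\<^esub> u"
    using separable by (elim exE conjE) (rule that, blast+)
  have H_Hom: "H X Y b \<in> Hom D X Y"
    if "X \<in> Obj D" "Y \<in> Obj D" "b \<in> Hom C (omap F X) (omap F Y)" for X Y b
    using hom[OF that(1,2)] that(3) unfolding hom_def hom_group_def by auto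
  show thesis
  proof (rule that[of H])
    show "H X Y (amap F a) = a" if "a \<in> Hom D X Y" for X Y a
      by (rule ret) (use that in auto)
    show "H X' Y (b \<cdot>\<^bsub>C\<^esub> amap F a) = H X Y b \<cdot>\<^bsub>D\<^esub> a"
      if "a \<in> Hom D X' X" "Y \<in> Obj D" "b \<in> Hom C (omap F X) (omap F Y)" for X X' Y a b
    proof -
      have "X' \<in> Obj D" "X \<in> Obj D" using that by auto
      then show ?thesis using nat[of X' X Y Y a b "Id D Y"] H_Hom[of X Y b] that by simp
    qed
    show "H X Y' (amap F a \<cdot>\<^bsub>C\<^esub> b) = a \<cdot>\<^bsub>D\<^esub> H X Y b"
      if "a \<in> Hom D Y Y'" "X \<in> Obj D" "b \<in> Hom C (omap F X) (omap F Y)" for X Y Y' a b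
    proof -
      have "Y \<in> Obj D" "Y' \<in> Obj D" using that by auto
      then show ?thesis using nat[of X X Y Y' "Id D X" b a] H_Hom[of X Y b] that by simp
    qed
  qed (rule H_Hom)
qed

text \<open>\<open>H\<close> sends the inverse of \<open>amap F a\<close> to an inverse of
  \<open>a\<close>: naturality on either side absorbs \<open>a\<close> into \<open>H\<close>,
  leaving \<open>H\<close> of an identity.\<close>

lemma reflects_iso:
  assumes a: "a \<in> Hom D X Y" and iso: "is_iso C (amap F a)"
  shows "is_iso D a"
proof -
  have X [simp]: "X \<in> Obj D" "Y \<in> Obj D" using a by auto
  obtain H where H: "\<And>X Y b. X \<in> Obj D \<Longrightarrow> Y \<in> Obj D \<Longrightarrow> b \<in> Hom C (omap F X) (omap F Y) \<Longrightarrow>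
       H X Y b \<in> Hom D X Y"
    "\<And>X Y a. a \<in> Hom D X Y \<Longrightarrow> H X Y (amap F a) = a"
    "\<And>X X' Y a b. a \<in> Hom D X' X \<Longrightarrow> Y \<in> Obj D \<Longrightarrow> b \<in> Hom C (omap F X) (omap F Y) \<Longrightarrow>
       H X' Y (b \<cdot>\<^bsub>C\<^esub> amap F a) = H X Y b \<cdot>\<^bsub>D\<^esub> a"
    "\<And>X Y Y' a b. a \<in> Hom D Y Y' \<Longrightarrow> X \<in> Obj D \<Longrightarrow> b \<in> Hom C (omap F X) (omap F Y) \<Longrightarrow>
       H X Y' (amap F a \<cdot>\<^bsub>C\<^esub> b) = a \<cdot>\<^bsub>D\<^esub> H X Y b"
    using separable_retraction by blast
  obtain g where g: "g \<in> Hom C (omap F Y) (omap F X)" "g \<cdot>\<^bsub>C\<^esub> amap F a = Id C (omap F X)"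
    "amap F a \<cdot>\<^bsub>C\<^esub> g = Id C (omap F Y)"
    using target.is_isoE[OF iso amap_Hom[OF a]] by blast
  have "H Y X g \<cdot>\<^bsub>D\<^esub> a = Id D X" using H(3)[OF a _ g(1)] H(2)[of "Id D X" X X] g(2) by simp
  moreover have "a \<cdot>\<^bsub>D\<^esub> H Y X g = Id D Y" using H(4)[OF a _ g(1)] H(2)[of "Id D Y" Y Y] g(3) by simp
  ultimately show ?thesis using source.is_isoI[OF a H(1)[OF _ _ g(1)]] by simp
qed

end

section \<open>Pulling back cones of maps into a biproduct\<close>

locale separable_exact_functor =
  exact_functor D SD TD C SC TC F \<epsilon> + separable_functor D C F + C: triangulated_category C SC TC
  for D :: "('o, 'm) addcat" and SD TD and C :: "('p, 'n) addcat" and SC TC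
    and F :: "('o, 'm, 'p, 'n) functor_maps" and \<epsilon>
begin

lemma \<epsilon>_simps [simp]:
  assumes "X \<in> Obj D"
  shows "\<epsilon> X \<in> Arr C" "Dom C (\<epsilon> X) = omap F (omap SD X)" "Cod C (\<epsilon> X) = omap SC (omap F X)"
    "is_iso C (\<epsilon> X)"
  using \<epsilon>_natural_iso assms unfolding natural_iso_def by (auto simp: comp_functor_def)

lemma \<epsilon>_natural:
  assumes "f \<in> Arr D"
  shows "amap SC (amap F f) \<cdot>\<^bsub>C\<^esub> \<epsilon> (Dom D f) = \<epsilon> (Cod D f) \<cdot>\<^bsub>C\<^esub> amap F (amap SD f)"
  using \<epsilon>_natural_iso assms unfolding natural_iso_def by (auto simp: comp_functor_def)

text \<open>
  Applying the retraction \<open>H\<close> to the octahedron in the target only yields a candidate triangle. Its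
  image differs from a distinguished one by an endomorphism \<open>\<theta>\<close> of the third object, and the
  compatibility of \<open>q\<close> with all of \<open>b\<close>, rather than just \<open>b \<cdot> iB\<close>, makes \<open>\<theta> - 1\<close> nilpotent.
\<close>

lemma cone_into_biproduct_source:
  assumes bp: "biproduct D A B M iA iB pA pB"
    and t: "(f, b, c) \<in> TD" and f: "f \<in> Hom D Y M" and t': "(pA \<cdot>\<^bsub>D\<^esub> f, a, a') \<in> TD"
  obtains q where "q \<in> Hom D (Cod D b) (Cod D a)" "q \<cdot>\<^bsub>D\<^esub> b = a \<cdot>\<^bsub>D\<^esub> pA" "a' \<cdot>\<^bsub>D\<^esub> q = c"
    "(b \<cdot>\<^bsub>D\<^esub> iB, q, Neg D (amap SD (pB \<cdot>\<^bsub>D\<^esub> f) \<cdot>\<^bsub>D\<^esub> a')) \<in> TD"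
proof -
  have [simp]: "M \<in> Obj D" "iB \<in> Arr D" "pA \<in> Arr D" "pB \<in> Arr D"
    "Dom D iB = B" "Cod D iB = M" "Dom D pA = M" "Dom D pB = M" "Cod D pA = A" "Cod D pB = B"
    using bp unfolding biproduct_def by auto
  have AB [simp]: "A \<in> Obj D" "B \<in> Obj D"
    using D.source.Cod_Obj[of pA] D.source.Dom_Obj[of iB] by simp_all
  have [simp]: "f \<in> Arr D" "Dom D f = Y" "Cod D f = M" using f by simp_all
  have [simp]: "Y \<in> Obj D" using D.source.Dom_Obj[of f] by simp
  note [simp] = D.dist_simps[OF t, simplified] D.dist_simps[OF t', simplified]
  let ?W = "Cod D b" and ?A1 = "Cod D a"
  define p where "p = b \<cdot>\<^bsub>D\<^esub> iB"
  define r where "r = Neg D (amap SD (pB \<cdot>\<^bsub>D\<^esub> f) \<cdot>\<^bsub>D\<^esub> a')"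
  have p [simp]: "p \<in> Arr D" "Dom D p = B" "Cod D p = ?W" by (simp_all add: p_def)
  have r [simp]: "r \<in> Arr D" "Dom D r = ?A1" "Cod D r = omap SD B" by (simp_all add: r_def)

  have tC: "(amap F f, amap F b, \<epsilon> Y \<cdot>\<^bsub>C\<^esub> amap F c) \<in> TC"
    using preserves_distinguished[OF t] by simp
  have tC': "(amap F pA \<cdot>\<^bsub>C\<^esub> amap F f, amap F a, \<epsilon> Y \<cdot>\<^bsub>C\<^esub> amap F a') \<in> TC"
    using preserves_distinguished[OF t'] by (simp add: amap_Comp')
  obtain g where g: "g \<in> Hom C (omap F ?W) (omap F ?A1)"
    and gb: "g \<cdot>\<^bsub>C\<^esub> amap F b = amap F a \<cdot>\<^bsub>C\<^esub> amap F pA"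
    and ag: "(\<epsilon> Y \<cdot>\<^bsub>C\<^esub> amap F a') \<cdot>\<^bsub>C\<^esub> g = \<epsilon> Y \<cdot>\<^bsub>C\<^esub> amap F c"
    and tg: "(amap F b \<cdot>\<^bsub>C\<^esub> amap F iB, g,
      Neg C (amap SC (amap F pB \<cdot>\<^bsub>C\<^esub> amap F f) \<cdot>\<^bsub>C\<^esub> (\<epsilon> Y \<cdot>\<^bsub>C\<^esub> amap F a'))) \<in> TC"
    by (rule C.cone_into_biproduct[OF amap_biproduct[OF bp] tC _ tC', of "omap F Y"]) simp_all
  note [simp] = g[simplified]
  \<comment> \<open>Naturality of \<open>\<epsilon>\<close> at \<open>pB \<cdot> f\<close> brings
    the connecting map into the form \<open>\<epsilon> B \<cdot> amap F r\<close>, so that the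
    triangle can be compared with images of triangles under the functor.\<close>
  have "amap SC (amap F pB \<cdot>\<^bsub>C\<^esub> amap F f) \<cdot>\<^bsub>C\<^esub> (\<epsilon> Y \<cdot>\<^bsub>C\<^esub> amap F a')
      = (amap SC (amap F (pB \<cdot>\<^bsub>D\<^esub> f)) \<cdot>\<^bsub>C\<^esub> \<epsilon> Y) \<cdot>\<^bsub>C\<^esub> amap F a'" by (simp add: amap_Comp')
  also have "\<dots> = (\<epsilon> B \<cdot>\<^bsub>C\<^esub> amap F (amap SD (pB \<cdot>\<^bsub>D\<^esub> f))) \<cdot>\<^bsub>C\<^esub> amap F a'"
    using \<epsilon>_natural[of "pB \<cdot>\<^bsub>D\<^esub> f"] by simp
  also have "\<dots> = \<epsilon> B \<cdot>\<^bsub>C\<^esub> amap F (amap SD (pB \<cdot>\<^bsub>D\<^esub> f) \<cdot>\<^bsub>D\<^esub> a')"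
    by (simp add: amap_Comp'[of a' "amap SD (pB \<cdot>\<^bsub>D\<^esub> f)"])
  finally have tg': "(amap F p, g, \<epsilon> B \<cdot>\<^bsub>C\<^esub> amap F r) \<in> TC"
    using tg by (simp add: p_def r_def amap_Comp'[of iB b])
  have ag': "amap F a' \<cdot>\<^bsub>C\<^esub> g = amap F c"
    by (rule C.source.Comp_cancel_iso_left[of "\<epsilon> Y"]) (use ag in simp_all)

  obtain H where H: "\<And>X Y b. X \<in> Obj D \<Longrightarrow> Y \<in> Obj D \<Longrightarrow> b \<in> Hom C (omap F X) (omap F Y) \<Longrightarrow>
       H X Y b \<in> Hom D X Y"
    "\<And>X Y a. a \<in> Hom D X Y \<Longrightarrow> H X Y (amap F a) = a"
    "\<And>X X' Y a b. a \<in> Hom D X' X \<Longrightarrow> Y \<in> Obj D \<Longrightarrow> b \<in> Hom C (omap F X) (omap F Y) \<Longrightarrow>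
       H X' Y (b \<cdot>\<^bsub>C\<^esub> amap F a) = H X Y b \<cdot>\<^bsub>D\<^esub> a"
    "\<And>X Y Y' a b. a \<in> Hom D Y Y' \<Longrightarrow> X \<in> Obj D \<Longrightarrow> b \<in> Hom C (omap F X) (omap F Y) \<Longrightarrow>
       H X Y' (amap F a \<cdot>\<^bsub>C\<^esub> b) = a \<cdot>\<^bsub>D\<^esub> H X Y b"
    using separable_retraction by blast
  \<comment> \<open>\<open>g\<close> need not come from \<open>D\<close>. As naturality lets
    \<open>H\<close> pull out \<open>b\<close> and \<open>a'\<close>, the pulled-back map
    \<open>q\<close> still satisfies both commutativities.\<close>
  define q where "q = H ?W ?A1 g"
  have q: "q \<in> Hom D ?W ?A1" unfolding q_def by (rule H(1)) simp_all
  note [simp] = q[simplified]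
  have "q \<cdot>\<^bsub>D\<^esub> b = H M ?A1 (g \<cdot>\<^bsub>C\<^esub> amap F b)" unfolding q_def by (rule H(3)[symmetric]) simp_all
  also have "\<dots> = H M ?A1 (amap F (a \<cdot>\<^bsub>D\<^esub> pA))" unfolding gb by (simp add: amap_Comp')
  also have "\<dots> = a \<cdot>\<^bsub>D\<^esub> pA" by (rule H(2)) simp
  finally have qb: "q \<cdot>\<^bsub>D\<^esub> b = a \<cdot>\<^bsub>D\<^esub> pA" .
  have "a' \<cdot>\<^bsub>D\<^esub> q = H ?W (omap SD Y) (amap F a' \<cdot>\<^bsub>C\<^esub> g)"
    unfolding q_def by (rule H(4)[symmetric]) simp_all
  also have "\<dots> = c" unfolding ag' by (rule H(2)) simp
  finally have a'q: "a' \<cdot>\<^bsub>D\<^esub> q = c" .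

  \<comment> \<open>An actual cone of \<open>p\<close>. Its image and the triangle through
    \<open>g\<close> are both cones of \<open>amap F p\<close>, hence isomorphic by
    \<open>\<psi>\<close>; \<open>\<gamma>\<close> is \<open>\<psi>\<close> pulled back by
    \<open>H\<close>, and the goal becomes its invertibility.\<close>
  obtain y z where ty: "(p, y, z) \<in> TD" using D.ex_dist[of p] by auto
  note [simp] = D.dist_simps[OF ty, simplified]
  let ?V = "Cod D y"
  have tyC: "(amap F p, amap F y, \<epsilon> B \<cdot>\<^bsub>C\<^esub> amap F z) \<in> TC"
    using preserves_distinguished[OF ty] by simp
  obtain \<psi> where \<psi>: "\<psi> \<in> Hom C (omap F ?V) (omap F ?A1)" "is_iso C \<psi>" "\<psi> \<cdot>\<^bsub>C\<^esub> amap F y = g"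
    "(\<epsilon> B \<cdot>\<^bsub>C\<^esub> amap F r) \<cdot>\<^bsub>C\<^esub> \<psi> = \<epsilon> B \<cdot>\<^bsub>C\<^esub> amap F z"
    by (rule C.cone_unique[OF tyC tg']) simp_all
  note [simp] = \<psi>(1)[simplified]
  have r\<psi>: "amap F r \<cdot>\<^bsub>C\<^esub> \<psi> = amap F z"
    by (rule C.source.Comp_cancel_iso_left[of "\<epsilon> B"]) (use \<psi>(4) in simp_all)
  obtain \<psi>' where \<psi>': "\<psi>' \<in> Hom C (omap F ?A1) (omap F ?V)" "\<psi>' \<cdot>\<^bsub>C\<^esub> \<psi> = Id C (omap F ?V)"
    "\<psi> \<cdot>\<^bsub>C\<^esub> \<psi>' = Id C (omap F ?A1)"
    by (rule C.source.is_isoE[OF \<psi>(2,1)])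
  note [simp] = \<psi>'(1)[simplified]
  define \<gamma> where "\<gamma> = H ?V ?A1 \<psi>"
  have \<gamma>: "\<gamma> \<in> Hom D ?V ?A1" unfolding \<gamma>_def by (rule H(1)) simp_all
  note [simp] = \<gamma>[simplified]
  have \<gamma>y: "\<gamma> \<cdot>\<^bsub>D\<^esub> y = q"
    unfolding \<gamma>_def q_def \<psi>(3)[symmetric] by (rule H(3)[symmetric]) simp_all
  have "r \<cdot>\<^bsub>D\<^esub> \<gamma> = H ?V (omap SD B) (amap F r \<cdot>\<^bsub>C\<^esub> \<psi>)"
    unfolding \<gamma>_def by (rule H(4)[symmetric]) simp_all
  also have "\<dots> = z" unfolding r\<psi> by (rule H(2)) simp
  finally have r\<gamma>: "r \<cdot>\<^bsub>D\<^esub> \<gamma> = z" .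

  \<comment> \<open>\<open>\<theta>\<close> measures how far \<open>amap F \<gamma>\<close> is from
    \<open>\<psi>\<close>, as \<open>amap F \<gamma> = \<theta> \<cdot> \<psi>\<close>. It turns
    \<open>g\<close> into \<open>amap F q\<close> and leaves \<open>amap F r\<close>
    unchanged.\<close>
  define \<theta> where "\<theta> = amap F \<gamma> \<cdot>\<^bsub>C\<^esub> \<psi>'"
  have \<theta> [simp]: "\<theta> \<in> Arr C" "Dom C \<theta> = omap F ?A1" "Cod C \<theta> = omap F ?A1"
    by (simp_all add: \<theta>_def)
  have "\<theta> \<cdot>\<^bsub>C\<^esub> g = amap F \<gamma> \<cdot>\<^bsub>C\<^esub> (\<psi>' \<cdot>\<^bsub>C\<^esub> (\<psi> \<cdot>\<^bsub>C\<^esub> amap F y))" unfolding \<theta>_def \<psi>(3) by simp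
  also have "\<psi>' \<cdot>\<^bsub>C\<^esub> (\<psi> \<cdot>\<^bsub>C\<^esub> amap F y) = amap F y"
    using C.source.Comp_reduce[OF \<psi>'(2), of "amap F y"] by simp
  also have "amap F \<gamma> \<cdot>\<^bsub>C\<^esub> amap F y = amap F q" unfolding \<gamma>y[symmetric] by (simp add: amap_Comp')
  finally have \<theta>g: "\<theta> \<cdot>\<^bsub>C\<^esub> g = amap F q" .
  have "amap F r \<cdot>\<^bsub>C\<^esub> \<theta> = amap F z \<cdot>\<^bsub>C\<^esub> \<psi>'"
    unfolding r\<gamma>[symmetric] \<theta>_def by (simp add: amap_Comp')
  also have "\<dots> = amap F r" unfolding r\<psi>[symmetric] by (simp add: \<psi>'(3))
  finally have r\<theta>: "amap F r \<cdot>\<^bsub>C\<^esub> \<theta> = amap F r" .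
  \<comment> \<open>Precomposed with \<open>amap F b\<close>, both \<open>amap F q\<close> and
    \<open>g\<close> become \<open>amap F (a \<cdot> pA)\<close>, so their difference factors
    through the connecting map of the image of \<open>(f, b, c)\<close>. As
    \<open>amap F c = amap F a' \<cdot> g\<close>, this supplies the factorisation in
    \<open>dist_endo_iso_of_factor\<close>, with \<open>x = amap F a'\<close>.\<close>
  have "Minus C (amap F q) g \<cdot>\<^bsub>C\<^esub> amap F b = Null C (omap F M) (omap F ?A1)"
    using qb gb by (simp add: C.source.Plus_Comp_distrib flip: amap_Comp')
  then obtain \<mu> where \<mu>: "\<mu> \<in> Hom C (omap SC (omap F Y)) (omap F ?A1)"
    "Minus C (amap F q) g = \<mu> \<cdot>\<^bsub>C\<^esub> (\<epsilon> Y \<cdot>\<^bsub>C\<^esub> amap F c)"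
    using C.dist_factor_connecting[OF tC, of "Minus C (amap F q) g" "omap F ?A1"] by auto
  have "is_iso C \<theta>"
  proof (rule C.dist_endo_iso_of_factor[OF tg', of _ "amap F a'" _ "\<mu> \<cdot>\<^bsub>C\<^esub> \<epsilon> Y"])
    show "amap F a' \<cdot>\<^bsub>C\<^esub> (\<theta> \<cdot>\<^bsub>C\<^esub> g) = amap F a' \<cdot>\<^bsub>C\<^esub> g"
      using a'q by (simp add: \<theta>g ag' flip: amap_Comp')
    show "Minus C (\<theta> \<cdot>\<^bsub>C\<^esub> g) g = (\<mu> \<cdot>\<^bsub>C\<^esub> \<epsilon> Y) \<cdot>\<^bsub>C\<^esub> (amap F a' \<cdot>\<^bsub>C\<^esub> g)"
      unfolding \<theta>g \<mu>(2) ag' using \<mu>(1) by simp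
  qed (use \<mu>(1) r\<theta> in simp_all)
  moreover have "amap F \<gamma> = \<theta> \<cdot>\<^bsub>C\<^esub> \<psi>" by (simp add: \<theta>_def \<psi>'(2))
  ultimately have "is_iso C (amap F \<gamma>)"
    using C.source.is_iso_Comp[OF \<psi>(1,2), of \<theta> "omap F ?A1"] by simp
  then have "is_iso D \<gamma>" by (rule reflects_iso[OF \<gamma>])
  then have "(p, q, r) \<in> TD"
    by (intro D.dist_iso[OF ty, of p B ?W q ?A1 r "Id D B" "Id D ?W" \<gamma>])
      (use \<gamma>y r\<gamma> D.source.is_iso_Id in simp_all)
  then show thesis using that[OF q qb a'q] by (simp add: p_def r_def)
qed

section \<open>Assembling the octahedron in the source\<close>

lemma octahedral_axiom: "TR4 D SD TD"
  unfolding TR4_def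
proof (intro allI impI)
  fix X Y Z X1 Y1 Z1 u v i i' j j' k k'
  assume u: "u \<in> Hom D X Y" and i: "i \<in> Hom D Y X1" and i': "i' \<in> Hom D X1 (omap SD X)"
    and tu: "(u, i, i') \<in> TD"
    and v: "v \<in> Hom D Y Z" and j: "j \<in> Hom D Z Z1" and j': "j' \<in> Hom D Z1 (omap SD Y)"
    and tv: "(v, j, j') \<in> TD"
    and k: "k \<in> Hom D Z Y1" and k': "k' \<in> Hom D Y1 (omap SD X)"
    and tvu: "(v \<cdot>\<^bsub>D\<^esub> u, k, k') \<in> TD"
  have [simp]: "X \<in> Obj D" "Y \<in> Obj D" "Z \<in> Obj D" "X1 \<in> Obj D" "Y1 \<in> Obj D" "Z1 \<in> Obj D"
    using u v i j k by auto
  note [simp] = u[simplified] v[simplified] i[simplified] j[simplified] k[simplified]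
    i'[simplified] j'[simplified] k'[simplified]
  obtain M i1 i2 p1 p2 where bp: "biproduct D X1 Z M i1 i2 p1 p2"
    using D.source.ex_biproduct[of X1 Z] by auto
  have [simp]: "M \<in> Obj D" "i1 \<in> Arr D" "i2 \<in> Arr D" "p1 \<in> Arr D" "p2 \<in> Arr D"
    "Dom D i1 = X1" "Dom D i2 = Z" "Cod D i1 = M" "Cod D i2 = M"
    "Dom D p1 = M" "Dom D p2 = M" "Cod D p1 = X1" "Cod D p2 = Z"
    "p1 \<cdot>\<^bsub>D\<^esub> i1 = Id D X1" "p2 \<cdot>\<^bsub>D\<^esub> i2 = Id D Z"
    "p1 \<cdot>\<^bsub>D\<^esub> i2 = Null D Z X1" "p2 \<cdot>\<^bsub>D\<^esub> i1 = Null D X1 Z"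
    using bp unfolding biproduct_def by auto
  \<comment> \<open>With this sign, \<open>b \<cdot> f = 0\<close> says that
    \<open>b \<cdot> i1\<close> and \<open>b \<cdot> i2\<close> complete \<open>i\<close> and
    \<open>v\<close> to a commutative square, the source of
    \<open>u' \<cdot> i = k \<cdot> v\<close>.\<close>
  define f where "f = Minus D (i1 \<cdot>\<^bsub>D\<^esub> i) (i2 \<cdot>\<^bsub>D\<^esub> v)"
  have f [simp]: "f \<in> Arr D" "Dom D f = Y" "Cod D f = M" by (simp_all add: f_def)
  have p1f: "p1 \<cdot>\<^bsub>D\<^esub> f = i"
    using D.source.Comp_reduce[of p1 i1 _ i] D.source.Comp_reduce[of p1 i2 _ v]
    by (simp add: f_def D.source.Comp_Plus_distrib)
  have p2f: "p2 \<cdot>\<^bsub>D\<^esub> f = Neg D v"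
    using D.source.Comp_reduce[of p2 i1 _ i] D.source.Comp_reduce[of p2 i2 _ v]
    by (simp add: f_def D.source.Comp_Plus_distrib)
  obtain b c where t: "(f, b, c) \<in> TD" using D.ex_dist[of f] by auto
  note [simp] = D.dist_simps[OF t, simplified]
  let ?W = "Cod D b"
  have biv: "b \<cdot>\<^bsub>D\<^esub> (i1 \<cdot>\<^bsub>D\<^esub> i) = b \<cdot>\<^bsub>D\<^esub> (i2 \<cdot>\<^bsub>D\<^esub> v)"
    by (rule D.source.Minus_eq_NullD)
      (use D.dist_simps(7)[OF t] in \<open>simp_all add: f_def D.source.Comp_Plus_distrib\<close>)

  \<comment> \<open>First projection: \<open>p1 \<cdot> f = i\<close>, whose cone is given by
    rotating the triangle on \<open>u\<close>. The signs from \<open>p2 \<cdot> f = - v\<close>,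
    from the rotation and from the cone lemma combine to \<open>- amap SD (v \<cdot> u)\<close>, so
    this is a rotated triangle on \<open>v \<cdot> u\<close>.\<close>
  obtain l where l: "l \<in> Hom D ?W (omap SD X)" "l \<cdot>\<^bsub>D\<^esub> b = i' \<cdot>\<^bsub>D\<^esub> p1" "Neg D (amap SD u) \<cdot>\<^bsub>D\<^esub> l = c"
    and tl: "(b \<cdot>\<^bsub>D\<^esub> i2, l, Neg D (amap SD (p2 \<cdot>\<^bsub>D\<^esub> f) \<cdot>\<^bsub>D\<^esub> Neg D (amap SD u))) \<in> TD"
    using cone_into_biproduct_source[OF bp t, of Y i' "Neg D (amap SD u)"] D.dist_rotate[OF tu] p1f
    by auto
  note [simp] = l(1)[simplified]
  have tl': "(b \<cdot>\<^bsub>D\<^esub> i2, l, Neg D (amap SD (v \<cdot>\<^bsub>D\<^esub> u))) \<in> TD"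
    using tl by (simp add: p2f D.amap_Comp')
  have "(v \<cdot>\<^bsub>D\<^esub> u, b \<cdot>\<^bsub>D\<^esub> i2, l) \<in> TD"
  proof (rule D.dist_rotate_back[OF tl'])
    \<comment> \<open>The commutative square replaces \<open>i2 \<cdot> v\<close> by
      \<open>i1 \<cdot> i\<close>, and \<open>i \<cdot> u = 0\<close>.\<close>
    have "b \<cdot>\<^bsub>D\<^esub> (i2 \<cdot>\<^bsub>D\<^esub> (v \<cdot>\<^bsub>D\<^esub> u)) = (b \<cdot>\<^bsub>D\<^esub> (i2 \<cdot>\<^bsub>D\<^esub> v)) \<cdot>\<^bsub>D\<^esub> u" by simp
    also have "\<dots> = b \<cdot>\<^bsub>D\<^esub> (i1 \<cdot>\<^bsub>D\<^esub> (i \<cdot>\<^bsub>D\<^esub> u))" unfolding biv[symmetric] by simp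
    also have "\<dots> = Null D X ?W" using D.dist_simps(7)[OF tu] by simp
    finally have 1: "b \<cdot>\<^bsub>D\<^esub> (i2 \<cdot>\<^bsub>D\<^esub> (v \<cdot>\<^bsub>D\<^esub> u)) = Null D X ?W" .
    have 2: "l \<cdot>\<^bsub>D\<^esub> (b \<cdot>\<^bsub>D\<^esub> i2) = Null D Z (omap SD X)" using D.dist_simps(7)[OF tl'] by simp
    have "Neg D (amap SD (v \<cdot>\<^bsub>D\<^esub> u) \<cdot>\<^bsub>D\<^esub> l) = Null D ?W (omap SD Z)"
      using D.dist_simps(8)[OF tl'] by simp
    then have "Neg D (Neg D (amap SD (v \<cdot>\<^bsub>D\<^esub> u) \<cdot>\<^bsub>D\<^esub> l)) = Neg D (Null D ?W (omap SD Z))" by simp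
    then have 3: "amap SD (v \<cdot>\<^bsub>D\<^esub> u) \<cdot>\<^bsub>D\<^esub> l = Null D ?W (omap SD Z)" by simp
    show "candidate_triangle D SD (v \<cdot>\<^bsub>D\<^esub> u, b \<cdot>\<^bsub>D\<^esub> i2, l)"
      unfolding candidate_triangle_def using 1 2 3 by simp
  qed
  \<comment> \<open>\<open>?W\<close> is now a cone of \<open>v \<cdot> u\<close>, and
    \<open>\<alpha>\<close> identifies it with the given cone \<open>Y1\<close>.\<close>
  from D.cone_unique[OF this tvu] obtain \<alpha> where \<alpha>: "\<alpha> \<in> Hom D ?W Y1" "is_iso D \<alpha>"
    "\<alpha> \<cdot>\<^bsub>D\<^esub> (b \<cdot>\<^bsub>D\<^esub> i2) = k" "k' \<cdot>\<^bsub>D\<^esub> \<alpha> = l"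
    by auto
  obtain \<beta> where \<beta>: "\<beta> \<in> Hom D Y1 ?W" "\<beta> \<cdot>\<^bsub>D\<^esub> \<alpha> = Id D ?W" "\<alpha> \<cdot>\<^bsub>D\<^esub> \<beta> = Id D Y1"
    by (rule D.source.is_isoE[OF \<alpha>(2,1)])
  note [simp] = \<alpha>(1)[simplified] \<beta>(1)[simplified]

  \<comment> \<open>Second projection: \<open>p2 \<cdot> f\<close> is \<open>- v\<close>. The
    isomorphism \<open>-1\<close> on \<open>Y\<close> changes the signs of the first and third maps
    of the triangle on \<open>v\<close> together.\<close>
  have "is_iso D (Neg D (Id D Y))" by (rule D.source.is_isoI[of _ Y Y "Neg D (Id D Y)"]) simp_all
  then have tv': "(p2 \<cdot>\<^bsub>D\<^esub> f, j, Neg D j') \<in> TD"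
    unfolding p2f
    by (intro D.dist_iso[OF tv, of _ Y Z j Z1 _ "Neg D (Id D Y)" "Id D Z" "Id D Z1"])
      (simp_all add: D.source.is_iso_Id)
  \<comment> \<open>With the summands swapped, the two minus signs cancel and leave
    \<open>amap SD i \<cdot> j'\<close> as connecting map.\<close>
  obtain q where q: "q \<in> Hom D ?W Z1" "q \<cdot>\<^bsub>D\<^esub> b = j \<cdot>\<^bsub>D\<^esub> p2" "Neg D j' \<cdot>\<^bsub>D\<^esub> q = c"
    and tq: "(b \<cdot>\<^bsub>D\<^esub> i1, q, Neg D (amap SD (p1 \<cdot>\<^bsub>D\<^esub> f) \<cdot>\<^bsub>D\<^esub> Neg D j')) \<in> TD"
    using cone_into_biproduct_source[OF D.source.biproduct_swap[OF bp] t _ tv', of Y] by auto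
  note [simp] = q(1)[simplified]
  have tq': "(b \<cdot>\<^bsub>D\<^esub> i1, q, amap SD i \<cdot>\<^bsub>D\<^esub> j') \<in> TD" using tq by (simp add: p1f)

  \<comment> \<open>The octahedron's maps are \<open>b \<cdot> i1\<close> and \<open>q\<close>,
    carried from \<open>?W\<close> to \<open>Y1\<close> along \<open>\<alpha>\<close>.\<close>
  define u' where "u' = \<alpha> \<cdot>\<^bsub>D\<^esub> (b \<cdot>\<^bsub>D\<^esub> i1)"
  define v' where "v' = q \<cdot>\<^bsub>D\<^esub> \<beta>"
  have u' [simp]: "u' \<in> Arr D" "Dom D u' = X1" "Cod D u' = Y1" by (simp_all add: u'_def)
  have v' [simp]: "v' \<in> Arr D" "Dom D v' = Y1" "Cod D v' = Z1" by (simp_all add: v'_def)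
  have v'\<alpha>: "v' \<cdot>\<^bsub>D\<^esub> \<alpha> = q" by (simp add: v'_def \<beta>(2))
  have "u' \<cdot>\<^bsub>D\<^esub> i = (\<alpha> \<cdot>\<^bsub>D\<^esub> (b \<cdot>\<^bsub>D\<^esub> i2)) \<cdot>\<^bsub>D\<^esub> v" by (simp add: u'_def biv)
  then have 1: "u' \<cdot>\<^bsub>D\<^esub> i = k \<cdot>\<^bsub>D\<^esub> v" unfolding \<alpha>(3) .
  have "v' \<cdot>\<^bsub>D\<^esub> k = (v' \<cdot>\<^bsub>D\<^esub> \<alpha>) \<cdot>\<^bsub>D\<^esub> (b \<cdot>\<^bsub>D\<^esub> i2)" unfolding \<alpha>(3)[symmetric] by simp
  also have "\<dots> = (q \<cdot>\<^bsub>D\<^esub> b) \<cdot>\<^bsub>D\<^esub> i2" unfolding v'\<alpha> by simp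
  also have "\<dots> = j" unfolding q(2) by simp
  finally have 2: "v' \<cdot>\<^bsub>D\<^esub> k = j" .
  have "k' \<cdot>\<^bsub>D\<^esub> u' = (k' \<cdot>\<^bsub>D\<^esub> \<alpha>) \<cdot>\<^bsub>D\<^esub> (b \<cdot>\<^bsub>D\<^esub> i1)" by (simp add: u'_def)
  also have "\<dots> = (l \<cdot>\<^bsub>D\<^esub> b) \<cdot>\<^bsub>D\<^esub> i1" unfolding \<alpha>(4) by simp
  also have "\<dots> = i'" unfolding l(2) by simp
  finally have 3: "k' \<cdot>\<^bsub>D\<^esub> u' = i'" .
  \<comment> \<open>\<open>- j' \<cdot> q\<close> and \<open>- amap SD u \<cdot> l\<close> both
    equal the connecting map \<open>c\<close> of the cone of \<open>f\<close>; here it matters that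
    the two triangles share that cone.\<close>
  have "(j' \<cdot>\<^bsub>D\<^esub> v') \<cdot>\<^bsub>D\<^esub> \<alpha> = Neg D (Neg D j' \<cdot>\<^bsub>D\<^esub> q)" by (simp add: v'\<alpha>)
  also have "\<dots> = (amap SD u \<cdot>\<^bsub>D\<^esub> k') \<cdot>\<^bsub>D\<^esub> \<alpha>" unfolding q(3) l(3)[symmetric] by (simp add: \<alpha>(4))
  finally have 4: "j' \<cdot>\<^bsub>D\<^esub> v' = amap SD u \<cdot>\<^bsub>D\<^esub> k'"
    by (rule D.source.Comp_cancel_iso[OF \<alpha>(2), rotated -1]) simp_all
  have "(u', v', amap SD i \<cdot>\<^bsub>D\<^esub> j') \<in> TD"
    by (rule D.dist_iso[OF tq', of u' X1 Y1 v' Z1 _ "Id D X1" \<alpha> "Id D Z1"])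
      (use \<alpha>(2) v'\<alpha> D.source.is_iso_Id in \<open>simp_all add: u'_def\<close>)
  then show "\<exists>u' \<in> Hom D X1 Y1. \<exists>v' \<in> Hom D Y1 Z1.
      u' \<cdot>\<^bsub>D\<^esub> i = k \<cdot>\<^bsub>D\<^esub> v \<and> v' \<cdot>\<^bsub>D\<^esub> k = j \<and> k' \<cdot>\<^bsub>D\<^esub> u' = i' \<and>
      j' \<cdot>\<^bsub>D\<^esub> v' = amap SD u \<cdot>\<^bsub>D\<^esub> k' \<and> (u', v', amap SD i \<cdot>\<^bsub>D\<^esub> j') \<in> TD"
    by (intro bexI[of _ u'] bexI[of _ v'] conjI 1 2 3 4) simp_all
qed

end

theorem theoremE:
  fixes D :: "('o, 'm) addcat"
    and \<Sigma>\<^sub>D :: "('o, 'm, 'o, 'm) functor_maps"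
    and T\<^sub>D :: "('m \<times> 'm \<times> 'm) set"
    and C :: "('p, 'n) addcat"
    and \<Sigma>\<^sub>C :: "('p, 'n, 'p, 'n) functor_maps"
    and T\<^sub>C :: "('n \<times> 'n \<times> 'n) set"
    and F :: "('o, 'm, 'p, 'n) functor_maps"
    and \<epsilon> :: "'o \<Rightarrow> 'n"
  assumes "pretriangulated_category D \<Sigma>\<^sub>D T\<^sub>D"
    and "triangulated_category C \<Sigma>\<^sub>C T\<^sub>C"
    and "exact_functor D \<Sigma>\<^sub>D T\<^sub>D C \<Sigma>\<^sub>C T\<^sub>C F \<epsilon>"
    and "separable_functor D C F"
  shows "TR4 D \<Sigma>\<^sub>D T\<^sub>D"
proof -
  interpret separable_exact_functor D \<Sigma>\<^sub>D T\<^sub>D C \<Sigma>\<^sub>C T\<^sub>C F \<epsilon>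
    using assms by (simp add: separable_exact_functor_def)
  show ?thesis by (rule octahedral_axiom)
qed

end
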